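(* Let $G,H$ be groups such that $G/G'$ and $H/H'$ are finitely generated. Then the following properties are equivalent: 1) $G\times\mathbb{Z}\cong H\times\mathbb{Z}$; 2) for each integer $k\geq 1$, there exists an injective homomorphism $f_{k}:G\rightarrow H$ with $H=f_{k}(G)Z(H)$ and $|H/f_{k}(G)|$ (finite and) prime to $k$; 3) for the particular integer $k=|\Gamma(H)/(Z(H)\Delta(H))|\cdot|\Delta(H)/H'|$, there exists an injective homomorphism $f_{k}:G\rightarrow H$ with $H=f_{k}(G)Z(H)$ and $|H/f_{k}(G)|$ (finite and) prime to $k$.
   Context: For a group $M$, $Z(M)$ is the center of $M$ and $M'$ is the subgroup generated by the commutators $[x,y]$, $x,y\in M$. For subsets $A,B$ of a group, $AB=\{xy\mid x\in A,\ y\in B\}$. For a subgroup $S$ of $M$ with $M'\subset S$, the isolator of $S$ in $M$ is the subgroup $I_M(S)=\bigcup_{k\geq 1}\{x\in M\mid x^{k}\in S\}$. One writes $\Gamma(M)=I_M(Z(M)M')$ and $\Delta(M)=I_M(M')$. *)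

theory Defs
  imports "HOL-Algebra.Algebra"
begin

definition finitely_generated_group :: "('a, 'm) monoid_scheme \<Rightarrow> bool" where
  "finitely_generated_group M \<longleftrightarrow>
     (\<exists>S. finite S \<and> S \<subseteq> carrier M \<and> generate M S = carrier M)"

definition group_center :: "('a, 'm) monoid_scheme \<Rightarrow> 'a set" where
  "group_center M = {z \<in> carrier M. \<forall>x \<in> carrier M. z \<otimes>\<^bsub>M\<^esub> x = x \<otimes>\<^bsub>M\<^esub> z}"

abbreviation commutator_subgroup :: "('a, 'm) monoid_scheme \<Rightarrow> 'a set" where
  "commutator_subgroup M \<equiv> derived M (carrier M)"

(* Only meant for subgroups S containing the commutator subgroup; the isolator is then
   again a subgroup. *)
definition isolator :: "('a, 'm) monoid_scheme \<Rightarrow> 'a set \<Rightarrow> 'a set" where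
  "isolator M S = (\<Union>k \<in> {1::nat..}. {x \<in> carrier M. x [^]\<^bsub>M\<^esub> k \<in> S})"

definition Gamma_subgroup :: "('a, 'm) monoid_scheme \<Rightarrow> 'a set" where
  "Gamma_subgroup M = isolator M (group_center M <#>\<^bsub>M\<^esub> commutator_subgroup M)"

definition Delta_subgroup :: "('a, 'm) monoid_scheme \<Rightarrow> 'a set" where
  "Delta_subgroup M = isolator M (commutator_subgroup M)"

end

theory Submission
  imports Defs
begin

text \<open>
An isomorphism \<open>G \<times> \<int> \<cong> H \<times> \<int>\<close> presents one group as a product with an infinite cyclic
central factor in two ways. Projecting a suitable complement of the first cyclic factor along the second
gives the embeddings. Complements of the first factor are graphs of homomorphisms \<open>G \<rightarrow> \<int>\<close>. The
isomorphism itself supplies such a homomorphism, and its multiples move the index of the image through an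
arithmetic progression whose first term and difference are coprime, so the index can be made prime to any
given \<open>k\<close> (\<open>coprime_central_embedding_if_times_integers_iso\<close>).

For the converse let \<open>K \<subseteq> H\<close> be the image of an embedding. Since \<open>H = K Z(H)\<close>, commutators of \<open>H\<close> are
commutators of elements of \<open>K\<close>, so \<open>H' \<subseteq> K\<close>. Since the index of \<open>K\<close> is prime to \<open>|\<Delta>(H)/H'|\<close>, even
\<open>\<Delta>(H) \<subseteq> K\<close>. Now \<open>H\<close> is obtained from \<open>K\<close> by adjoining finitely many central elements, and each of
these by extracting roots \<open>a\<close> of prime degree \<open>p\<close>. Such a step preserves the product with \<open>\<int>\<close> as soon as
there is a homomorphism \<open>K \<rightarrow> \<int>\<close> whose value at \<open>a\<^sup>p\<close> is prime to \<open>p\<close>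
(\<open>adjoin_times_integers_iso\<close>). It exists because \<open>K/\<Delta>(H)\<close> is free abelian of finite rank and \<open>a\<^sup>p\<close> is not
a \<open>p\<close>-th power in it: a \<open>p\<close>-th root \<open>g\<close> would satisfy \<open>(a g\<^sup>-\<^sup>1)\<^sup>p \<in> \<Delta>(H)\<close>, which forces
\<open>a \<in> K\<close> (\<open>finite_central_extension_times_integers_iso\<close>).

Freeness enters only through the existence of homomorphisms to \<open>\<int>\<close> that are prime to \<open>p\<close> at elements
outside the \<open>p\<close>-th powers. This is proved directly, by adjoining generators one at a time
(\<open>finitely_generated_detect_powers\<close>). A similar induction shows that the torsion of a finitely generated
abelian group is finite, so the particular \<open>k\<close> of the third property is positive and that property is an
instance of the second.
\<close>

section \<open>The center\<close>

lemma (in group) center_subgroup: "subgroup (group_center G) G"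
proof (rule subgroupI)
  show "group_center G \<subseteq> carrier G" "group_center G \<noteq> {}"
    by (auto simp: group_center_def intro!: exI[of _ \<one>])
next
  fix a assume "a \<in> group_center G"
  then have ac: "a \<in> carrier G" and a: "\<And>x. x \<in> carrier G \<Longrightarrow> a \<otimes> x = x \<otimes> a"
    by (auto simp: group_center_def)
  have "inv a \<otimes> x = x \<otimes> inv a" if x: "x \<in> carrier G" for x
  proof -
    have "a \<otimes> (x \<otimes> inv a) = x" using a[OF x] ac x by (simp flip: m_assoc) (simp add: m_assoc)
    then show ?thesis using ac x by (metis inv_closed inv_solve_left m_closed)
  qed
  then show "inv a \<in> group_center G" using ac by (auto simp: group_center_def)
next
  fix a b assume "a \<in> group_center G" "b \<in> group_center G"
  then have ac: "a \<in> carrier G" and a: "\<And>x. x \<in> carrier G \<Longrightarrow> a \<otimes> x = x \<otimes> a"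
    and bc: "b \<in> carrier G" and b: "\<And>x. x \<in> carrier G \<Longrightarrow> b \<otimes> x = x \<otimes> b"
    by (auto simp: group_center_def)
  have "a \<otimes> b \<otimes> x = x \<otimes> (a \<otimes> b)" if x: "x \<in> carrier G" for x
  proof -
    have "a \<otimes> b \<otimes> x = a \<otimes> (x \<otimes> b)" using ac bc x b[OF x] by (simp add: m_assoc)
    also have "\<dots> = (x \<otimes> a) \<otimes> b" using ac bc x a[OF x] by (simp flip: m_assoc)
    finally show ?thesis using ac bc x by (simp add: m_assoc)
  qed
  then show "a \<otimes> b \<in> group_center G" using ac bc by (auto simp: group_center_def)
qed

lemma center_carrier: "a \<in> group_center G \<Longrightarrow> a \<in> carrier G"
  by (simp add: group_center_def)

lemma center_commutes:
  "a \<in> group_center G \<Longrightarrow> x \<in> carrier G \<Longrightarrow> a \<otimes>\<^bsub>G\<^esub> x = x \<otimes>\<^bsub>G\<^esub> a"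
  by (simp add: group_center_def)

lemma (in comm_group) center_eq_carrier: "group_center G = carrier G"
  by (auto simp: group_center_def m_comm)

lemma (in group) center_int_pow: "a \<in> group_center G \<Longrightarrow> a [^] (k::int) \<in> group_center G"
  by (rule subgroup_int_pow_closed[OF center_subgroup])

lemma (in group) center_nat_pow: "a \<in> group_center G \<Longrightarrow> a [^] (k::nat) \<in> group_center G"
  using center_int_pow[of a "int k"] by (simp add: int_pow_int)

lemma (in group) mult_center_pow:
  assumes "a \<in> group_center G" "b \<in> carrier G" "b' \<in> carrier G"
  shows "(b \<otimes> a [^] (m::int)) \<otimes> (b' \<otimes> a [^] (m'::int)) = (b \<otimes> b') \<otimes> a [^] (m + m')"
proof -
  have c: "a [^] m \<in> group_center G" and ac: "a \<in> carrier G"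
    using assms center_int_pow center_carrier by auto
  then have cc: "a [^] m \<in> carrier G" "a [^] m' \<in> carrier G" by auto
  have "(b \<otimes> a [^] m) \<otimes> (b' \<otimes> a [^] m') = b \<otimes> (a [^] m \<otimes> b') \<otimes> a [^] m'"
    using assms cc by (simp add: m_assoc)
  also have "\<dots> = b \<otimes> (b' \<otimes> a [^] m) \<otimes> a [^] m'"
    by (simp only: center_commutes[OF c assms(3)])
  also have "\<dots> = (b \<otimes> b') \<otimes> a [^] (m + m')"
    using assms cc ac by (simp add: m_assoc int_pow_mult)
  finally show ?thesis .
qed

section \<open>Adjoining a central element\<close>

text \<open>For \<open>K\<close> a subgroup and \<open>a\<close> central this is the subgroup generated by \<open>K\<close> and \<open>a\<close>. The explicit
form is kept because every map out of it used below is given by a formula in \<open>b\<close> and \<open>m\<close>.\<close>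
definition adjoin :: "('a, 'm) monoid_scheme \<Rightarrow> 'a set \<Rightarrow> 'a \<Rightarrow> 'a set" where
  "adjoin M K a = {b \<otimes>\<^bsub>M\<^esub> a [^]\<^bsub>M\<^esub> (m::int) | b m. b \<in> K}"

lemma adjoinI: "b \<in> K \<Longrightarrow> b \<otimes>\<^bsub>M\<^esub> a [^]\<^bsub>M\<^esub> (m::int) \<in> adjoin M K a"
  by (auto simp: adjoin_def)

lemma adjoinE:
  assumes "x \<in> adjoin M K a"
  obtains b m where "b \<in> K" "x = b \<otimes>\<^bsub>M\<^esub> a [^]\<^bsub>M\<^esub> (m::int)"
  using assms by (auto simp: adjoin_def)

lemma (in group) subset_adjoin: "subgroup K G \<Longrightarrow> K \<subseteq> adjoin G K a"
  using adjoinI[of _ K G a 0] by (fastforce dest: subgroup.mem_carrier)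

lemma (in group) mem_adjoin: "subgroup K G \<Longrightarrow> a \<in> carrier G \<Longrightarrow> a \<in> adjoin G K a"
  using adjoinI[of \<one> K G a 1] by (simp add: subgroup.one_closed)

lemma (in group) adjoin_subset:
  "subgroup L G \<Longrightarrow> K \<subseteq> L \<Longrightarrow> a \<in> L \<Longrightarrow> adjoin G K a \<subseteq> L"
  by (auto elim!: adjoinE intro: subgroup.m_closed subgroup_int_pow_closed)

lemma (in group) adjoin_subgroup:
  assumes K: "subgroup K G" and a: "a \<in> group_center G"
  shows "subgroup (adjoin G K a) G"
proof (rule subgroupI)
  interpret K: subgroup K G by (rule K)
  note ac = center_carrier[OF a]
  show "adjoin G K a \<subseteq> carrier G" using ac by (auto elim!: adjoinE)
  show "adjoin G K a \<noteq> {}" using subset_adjoin[OF K, of a] K.one_closed by blast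
  fix x assume "x \<in> adjoin G K a"
  then obtain b m where x: "b \<in> K" "x = b \<otimes> a [^] (m::int)" by (rule adjoinE)
  have "(b \<otimes> a [^] m) \<otimes> (inv b \<otimes> a [^] (-m)) = \<one>"
    by (subst mult_center_pow[OF a]) (use x(1) in simp_all)
  then have "inv b \<otimes> a [^] (-m) \<otimes> x = \<one>"
    unfolding x(2) by (rule inv_comm) (use x(1) ac in simp_all)
  then have "inv x = inv b \<otimes> a [^] (-m)"
    by (rule inv_equality) (use x ac in simp_all)
  then show "inv x \<in> adjoin G K a" using x adjoinI[of "inv b" K G a "-m"] by simp
  fix y assume "y \<in> adjoin G K a"
  then obtain b' m' where y: "b' \<in> K" "y = b' \<otimes> a [^] (m'::int)" by (rule adjoinE)
  show "x \<otimes> y \<in> adjoin G K a"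
    unfolding x(2) y(2)
    by (subst mult_center_pow[OF a]) (use x(1) y(1) in \<open>auto intro: adjoinI\<close>)
qed

lemma (in group) adjoin_mem: "subgroup K G \<Longrightarrow> a \<in> K \<Longrightarrow> adjoin G K a = K"
  using adjoin_subset[of K K a] subset_adjoin[of K a] by blast

lemma (in group) adjoin_adjoin_pow:
  assumes K: "subgroup K G" and a: "a \<in> group_center G"
  shows "adjoin G (adjoin G K (a [^] (q::nat))) a = adjoin G K a"
proof
  have aq: "subgroup (adjoin G K (a [^] q)) G"
    using adjoin_subgroup[OF K center_nat_pow[OF a]] .
  note L = adjoin_subgroup[OF K a]
  have 1: "a \<in> adjoin G K a" using mem_adjoin[OF K] center_carrier[OF a] by simp
  have "a [^] q \<in> adjoin G K a"
    using subgroup_int_pow_closed[OF L 1, of "int q"] by (simp add: int_pow_int)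
  then show "adjoin G (adjoin G K (a [^] q)) a \<subseteq> adjoin G K a"
    by (intro adjoin_subset[OF L] adjoin_subset[OF L] 1 subset_adjoin[OF K])
  have L2: "subgroup (adjoin G (adjoin G K (a [^] q)) a) G" using adjoin_subgroup[OF aq a] .
  show "adjoin G K a \<subseteq> adjoin G (adjoin G K (a [^] q)) a"
    using adjoin_subset[OF L2] subset_adjoin[OF K] subset_adjoin[OF aq]
      mem_adjoin[OF aq] center_carrier[OF a] by blast
qed

text \<open>An induction principle: if \<open>q\<close> is a prime divisor of \<open>d\<close> then \<open>a\<close> is adjoined by first adjoining
\<open>a\<^sup>q\<close>, whose order modulo \<open>K\<close> divides \<open>d / q\<close>, and then \<open>a\<close>, a \<open>q\<close>-th root of an element that is
already present. Hence properties of subgroups may be propagated one root of prime degree at a time.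
It is used for the detection of powers by characters and for the isomorphism
\<open>K \<times> \<int> \<cong> \<langle>K, a\<rangle> \<times> \<int>\<close>.\<close>
lemma (in group) adjoin_by_prime_steps:
  assumes step: "\<And>K a q. \<Phi> K \<Longrightarrow> a \<in> group_center G \<Longrightarrow> Factorial_Ring.prime (q::nat) \<Longrightarrow> a [^] q \<in> K
                   \<Longrightarrow> \<Phi> (adjoin G K a)"
    and sub: "\<And>K. \<Phi> K \<Longrightarrow> subgroup K G"
    and "\<Phi> K" "a \<in> group_center G" "(d::nat) \<ge> 1" "a [^] d \<in> K"
  shows "\<Phi> (adjoin G K a)"
  using assms(3-6)
proof (induction d arbitrary: K a rule: less_induct)
  case (less d)
  note ac = center_carrier[OF less.prems(2)]
  show ?case
  proof (cases "d = 1")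
    case True
    then show ?thesis using less.prems adjoin_mem[OF sub[OF less.prems(1)], of a] ac by simp
  next
    case False
    then obtain q where q: "Factorial_Ring.prime q" "q dvd d" using prime_factor_nat by blast
    then obtain e where e: "d = q * e" by blast
    have "e \<ge> 1" using e less.prems(3) by (cases e) auto
    then have "e < d" using e prime_gt_1_nat[OF q(1)] by simp
    have "(a [^] q) [^] e \<in> K" using less.prems(4) e ac by (simp add: nat_pow_pow)
    then have 1: "\<Phi> (adjoin G K (a [^] q))"
      using less.IH[OF \<open>e < d\<close> less.prems(1)] center_nat_pow[OF less.prems(2)] \<open>e \<ge> 1\<close> by blast
    have "a [^] q \<in> adjoin G K (a [^] q)" using mem_adjoin[OF sub[OF less.prems(1)]] ac by simp
    then have "\<Phi> (adjoin G (adjoin G K (a [^] q)) a)" using step[OF 1 less.prems(2) q(1)] by blast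
    then show ?thesis using adjoin_adjoin_pow[OF sub[OF less.prems(1)] less.prems(2)] by simp
  qed
qed

text \<open>The exponents \<open>k\<close> with \<open>a\<^sup>k \<in> K\<close> form an ideal of the integers; it contains \<open>p\<close> but not \<open>1\<close>, so
it is the maximal ideal generated by \<open>p\<close>.\<close>
lemma (in group) prime_dvd_exponent:
  assumes K: "subgroup K G" and a: "a \<in> carrier G" "a \<notin> K"
    and p: "Factorial_Ring.prime p" "a [^] p \<in> K" and k: "a [^] (k::int) \<in> K"
  obtains j where "k = int p * j" "a [^] k = (a [^] p) [^] (j::int)"
proof -
  have "int p dvd k"
  proof (rule ccontr)
    assume "\<not> int p dvd k"
    then have "coprime (int p) k" using p prime_imp_coprime[of "int p" k] by simp
    then obtain u v where uv: "u * int p + v * k = 1"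
      using bezout_int[of "int p" k] by auto
    have "a [^] (int p * u + k * v) = (a [^] p) [^] u \<otimes> (a [^] k) [^] v"
      using a by (simp add: int_pow_mult flip: int_pow_int int_pow_pow)
    also have "\<dots> \<in> K"
      using k p(2) subgroup_int_pow_closed[OF K] subgroup.m_closed[OF K] by blast
    finally show False using uv a by (simp add: mult.commute)
  qed
  then obtain j where "k = int p * j" by blast
  then show thesis using a that by (auto simp: int_pow_pow simp flip: int_pow_int)
qed

lemma (in group) generate_insert_eq_adjoin:
  assumes S: "S \<subseteq> carrier G" and a: "a \<in> group_center G"
  shows "generate G (insert a S) = adjoin G (generate G S) a"
proof
  note ac = center_carrier[OF a]
  note gS = generate_is_subgroup[OF S]
  have gi: "subgroup (generate G (insert a S)) G" using S ac by (intro generate_is_subgroup) auto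
  show "generate G (insert a S) \<subseteq> adjoin G (generate G S) a"
    using mem_adjoin[OF gS ac] subset_adjoin[OF gS, of a] generate.incl[of _ S G]
    by (intro generate_subgroup_incl[OF _ adjoin_subgroup[OF gS a]]) auto
  show "adjoin G (generate G S) a \<subseteq> generate G (insert a S)"
    by (intro adjoin_subset[OF gi] mono_generate) (auto intro: generate.incl)
qed

lemma (in group_hom) image_adjoin:
  assumes "K \<subseteq> carrier G" "a \<in> carrier G"
  shows "h ` adjoin G K a = adjoin H (h ` K) (h a)"
proof -
  have *: "h (b \<otimes> a [^] (m::int)) = h b \<otimes>\<^bsub>H\<^esub> h a [^]\<^bsub>H\<^esub> m" if "b \<in> K" for b m
    using assms that by (subst hom_mult) (auto simp: hom_int_pow)
  show ?thesis
  proof (intro equalityI subsetI)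
    fix y assume "y \<in> h ` adjoin G K a"
    then obtain b m where "b \<in> K" "y = h (b \<otimes> a [^] (m::int))" by (auto elim: adjoinE)
    then show "y \<in> adjoin H (h ` K) (h a)" using * adjoinI[of "h b" "h ` K" H "h a" m] by simp
  next
    fix y assume "y \<in> adjoin H (h ` K) (h a)"
    then obtain b m where "b \<in> K" "y = h b \<otimes>\<^bsub>H\<^esub> h a [^]\<^bsub>H\<^esub> (m::int)" by (auto elim: adjoinE)
    then show "y \<in> h ` adjoin G K a" using * adjoinI[of b K G a m] by (metis imageI)
  qed
qed

section \<open>Integer-valued characters that detect powers\<close>

lemma (in group) hom_int_pow_integer_group:
  assumes K: "subgroup K G" and \<chi>: "\<chi> \<in> hom (G\<lparr>carrier := K\<rparr>) integer_group" and x: "x \<in> K"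
  shows "\<chi> (x [^] (m::int)) = m * \<chi> x"
proof -
  interpret hm: group_hom "G\<lparr>carrier := K\<rparr>" integer_group \<chi>
    using \<chi> subgroup_imp_group[OF K] by (simp add: group_hom_def group_hom_axioms_def)
  show ?thesis using hm.hom_int_pow[of x m] x by (simp add: group.int_pow_consistent[OF group_axioms K x, symmetric])
qed

text \<open>The value \<open>c\<close> prescribed at \<open>a\<close> only has to agree with \<open>\<chi>\<close> on the powers of \<open>a\<close> that lie in \<open>K\<close>,
because two representations \<open>b a\<^sup>m = b' a\<^bsup>m'\<^esup>\<close> differ by such a power.\<close>
lemma (in group) hom_extends_to_adjoin:
  assumes K: "subgroup K G" and a: "a \<in> group_center G"
    and \<chi>: "\<chi> \<in> hom (G\<lparr>carrier := K\<rparr>) integer_group"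
    and compat: "\<And>k::int. a [^] k \<in> K \<Longrightarrow> \<chi> (a [^] k) = c * k"
  obtains \<psi> where "\<psi> \<in> hom (G\<lparr>carrier := adjoin G K a\<rparr>) integer_group"
    "\<And>b m. b \<in> K \<Longrightarrow> \<psi> (b \<otimes> a [^] (m::int)) = \<chi> b + c * m"
proof -
  interpret K: subgroup K G by (rule K)
  note ac = center_carrier[OF a]
  have \<chi>_mult: "\<chi> (b \<otimes> b') = \<chi> b + \<chi> b'" if "b \<in> K" "b' \<in> K" for b b'
    using \<chi> that by (simp add: hom_def)
  have wd: "\<chi> b + c * m = \<chi> b' + c * m'"
    if b: "b \<in> K" "b' \<in> K" and eq: "b \<otimes> a [^] m = b' \<otimes> a [^] m'" for b b' and m m' :: int
  proof -
    have "b \<otimes> a [^] (m - m') = b'"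
    proof -
      have "b \<otimes> a [^] (m - m') = (b \<otimes> a [^] m) \<otimes> inv (a [^] m')"
        using b ac by (simp add: int_pow_diff m_assoc)
      also have "\<dots> = b'" unfolding eq using b ac by (simp add: m_assoc)
      finally show ?thesis .
    qed
    then have "a [^] (m - m') = inv b \<otimes> b'" using b ac by (simp add: inv_solve_left)
    then have k: "a [^] (m - m') \<in> K" using b by simp
    have "\<chi> b' = \<chi> b + \<chi> (a [^] (m - m'))"
      using \<chi>_mult[OF b(1) k] \<open>b \<otimes> a [^] (m - m') = b'\<close> by simp
    then show ?thesis using compat[OF k] by (simp add: algebra_simps)
  qed
  define \<psi> where "\<psi> y = (THE v. \<exists>b\<in>K. \<exists>m::int. y = b \<otimes> a [^] m \<and> v = \<chi> b + c * m)" for y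
  have \<psi>: "\<psi> (b \<otimes> a [^] m) = \<chi> b + c * m" if "b \<in> K" for b and m :: int
    unfolding \<psi>_def
  proof (rule the_equality)
    show "\<exists>b'\<in>K. \<exists>m'. b \<otimes> a [^] m = b' \<otimes> a [^] m' \<and> \<chi> b + c * m = \<chi> b' + c * m'"
      using that by blast
    fix v assume "\<exists>b'\<in>K. \<exists>m'. b \<otimes> a [^] m = b' \<otimes> a [^] m' \<and> v = \<chi> b' + c * m'"
    then obtain b' m' where "b' \<in> K" "b \<otimes> a [^] m = b' \<otimes> a [^] m'" "v = \<chi> b' + c * m'"
      by (elim bexE exE conjE)
    then show "v = \<chi> b + c * m" using wd[OF that \<open>b' \<in> K\<close>] by simp
  qed
  show thesis
  proof (rule that[OF homI])
    fix x y
    assume "x \<in> carrier (G\<lparr>carrier := adjoin G K a\<rparr>)" "y \<in> carrier (G\<lparr>carrier := adjoin G K a\<rparr>)"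
    then obtain b m b' m' where "b \<in> K" "x = b \<otimes> a [^] (m::int)" "b' \<in> K" "y = b' \<otimes> a [^] (m'::int)"
      by (auto elim!: adjoinE)
    then show "\<psi> (x \<otimes>\<^bsub>G\<lparr>carrier := adjoin G K a\<rparr>\<^esub> y) = \<psi> x \<otimes>\<^bsub>integer_group\<^esub> \<psi> y"
      by (simp add: mult_center_pow[OF a] \<psi> \<chi>_mult algebra_simps)
  qed (use \<psi> in auto)
qed

definition torsion_free :: "('a, 'm) monoid_scheme \<Rightarrow> bool" where
  "torsion_free M \<longleftrightarrow> (\<forall>x\<in>carrier M. \<forall>k::nat. k \<ge> 1 \<longrightarrow> x [^]\<^bsub>M\<^esub> k = \<one>\<^bsub>M\<^esub> \<longrightarrow> x = \<one>\<^bsub>M\<^esub>)"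

text \<open>In a free abelian group of finite rank an element outside the \<open>p\<close>-th powers has a coordinate that is
not divisible by \<open>p\<close>. This consequence of freeness is all that is needed of the structure of finitely
generated abelian groups, and it can be carried along while elements are adjoined one at a time, where a
basis would have to be changed.\<close>
definition characters_detect_powers :: "('a, 'm) monoid_scheme \<Rightarrow> nat \<Rightarrow> 'a set \<Rightarrow> bool" where
  "characters_detect_powers M p B \<longleftrightarrow>
     (\<forall>x\<in>B. (\<forall>b\<in>B. x \<noteq> b [^]\<^bsub>M\<^esub> p) \<longrightarrow>
        (\<exists>\<psi> \<in> hom (M\<lparr>carrier := B\<rparr>) integer_group. \<not> int p dvd \<psi> x))"

lemma characters_detect_powersE:
  assumes "characters_detect_powers M p B" "x \<in> B" "\<And>b. b \<in> B \<Longrightarrow> x \<noteq> b [^]\<^bsub>M\<^esub> p"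
  obtains \<psi> where "\<psi> \<in> hom (M\<lparr>carrier := B\<rparr>) integer_group" "\<not> int p dvd \<psi> x"
  using assms unfolding characters_detect_powers_def by blast

lemma prime_not_dvd_int_mult:
  fixes u w :: int
  assumes "Factorial_Ring.prime p" "\<not> int p dvd u" "\<not> int p dvd w"
  shows "\<not> int p dvd u * w"
  using assms prime_dvd_mult_iff[of "int p" u w] by simp

text \<open>Here the adjoined element splits off as an infinite cyclic factor. If its exponent in \<open>x = b a\<^sup>m\<close> is
prime to \<open>p\<close>, the projection to that factor detects \<open>x\<close>; otherwise \<open>a\<^sup>m\<close> is a \<open>p\<close>-th power and the
question is one about \<open>b\<close>.\<close>
lemma (in comm_group) detect_powers_adjoin_independent:
  assumes B: "subgroup B G" and a: "a \<in> carrier G" and P: "characters_detect_powers G p B"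
    and indep: "\<And>k::int. a [^] k \<in> B \<Longrightarrow> k = 0"
  shows "characters_detect_powers G p (adjoin G B a)"
  unfolding characters_detect_powers_def
proof (intro ballI impI)
  interpret B: subgroup B G by (rule B)
  have az: "a \<in> group_center G" using a by (simp add: center_eq_carrier)
  fix x assume "x \<in> adjoin G B a" and npow: "\<forall>y\<in>adjoin G B a. x \<noteq> y [^] p"
  then obtain b m where x: "b \<in> B" "x = b \<otimes> a [^] (m::int)" by (auto elim: adjoinE)
  show "\<exists>\<psi>\<in>hom (G\<lparr>carrier := adjoin G B a\<rparr>) integer_group. \<not> int p dvd \<psi> x"
  proof (cases "int p dvd m")
    case False
    have "(\<lambda>_. 0) \<in> hom (G\<lparr>carrier := B\<rparr>) integer_group" by (simp add: hom_def)
    from hom_extends_to_adjoin[OF B az this, of 1] obtain \<psi>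
      where "\<psi> \<in> hom (G\<lparr>carrier := adjoin G B a\<rparr>) integer_group"
        "\<And>b m. b \<in> B \<Longrightarrow> \<psi> (b \<otimes> a [^] (m::int)) = 0 + 1 * m"
      using indep by auto
    then show ?thesis using False x by (intro bexI[of _ \<psi>]) auto
  next
    case True
    then obtain j where j: "m = j * int p" by (metis dvdE mult.commute)
    have "b \<noteq> c [^] p" if "c \<in> B" for c
    proof
      assume "b = c [^] p"
      then have "x = c [^] int p \<otimes> (a [^] j) [^] int p"
        using x(2) int_pow_pow[OF a, of j "int p"] by (simp only: int_pow_int j)
      also have "\<dots> = (c \<otimes> a [^] j) [^] p"
        using a that by (simp only: int_pow_distrib int_pow_closed B.mem_carrier flip: int_pow_int)
      finally show False using npow adjoinI[OF that] by blast
    qed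
    with P x(1) obtain \<chi> where \<chi>: "\<chi> \<in> hom (G\<lparr>carrier := B\<rparr>) integer_group" "\<not> int p dvd \<chi> b"
      by (blast elim: characters_detect_powersE)
    have "\<chi> (a [^] k) = 0 * k" if "a [^] k \<in> B" for k :: int
    proof -
      have "k = 0" using indep that by blast
      moreover have "\<chi> (\<one> [^] (0::int)) = 0"
        by (subst hom_int_pow_integer_group[OF B \<chi>(1)]) auto
      ultimately show ?thesis by simp
    qed
    from hom_extends_to_adjoin[OF B az \<chi>(1) this] obtain \<psi>
      where "\<psi> \<in> hom (G\<lparr>carrier := adjoin G B a\<rparr>) integer_group"
        "\<And>b m. b \<in> B \<Longrightarrow> \<psi> (b \<otimes> a [^] (m::int)) = \<chi> b + 0 * m"
      by blast
    then show ?thesis using \<chi> x by (intro bexI[of _ \<psi>]) auto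
  qed
qed

text \<open>Raising to the power \<open>q\<close> maps the larger group into \<open>B\<close>, and as \<open>q\<close> is invertible modulo \<open>p\<close> this
neither creates nor destroys \<open>p\<close>-th powers. So characters of \<open>B\<close> are pulled back along it.\<close>
lemma (in comm_group) detect_powers_adjoin_other_prime:
  assumes B: "subgroup B G" and a: "a \<in> carrier G" and p: "Factorial_Ring.prime p"
    and P: "characters_detect_powers G p B"
    and q: "Factorial_Ring.prime q" "p \<noteq> q" and aq: "a [^] q \<in> B"
  shows "characters_detect_powers G p (adjoin G B a)"
  unfolding characters_detect_powers_def
proof (intro ballI impI)
  interpret B: subgroup B G by (rule B)
  let ?A = "adjoin G B a"
  have az: "a \<in> group_center G" using a by (simp add: center_eq_carrier)
  note A = adjoin_subgroup[OF B az]
  have Aq: "y [^] int q \<in> B" if yA: "y \<in> ?A" for y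
  proof -
    obtain b m where y: "b \<in> B" "y = b \<otimes> a [^] (m::int)" by (rule adjoinE[OF yA])
    have "y [^] int q = b [^] int q \<otimes> (a [^] int q) [^] m"
      using y a by (simp add: int_pow_distrib int_pow_pow mult.commute)
    moreover have "a [^] int q \<in> B" using aq by (simp add: int_pow_int)
    ultimately show ?thesis
      using B.m_closed[OF subgroup_int_pow_closed[OF B y(1)] subgroup_int_pow_closed[OF B]] by simp
  qed
  fix x assume x: "x \<in> ?A" and npow: "\<forall>y\<in>?A. x \<noteq> y [^] p"
  have xc: "x \<in> carrier G" using x subgroup.mem_carrier[OF A] by blast
  have "coprime q p" using primes_coprime[OF q(1) p] q(2) by simp
  then have "gcd (int q) (int p) = 1" by simp
  then obtain u v where uv: "u * int q + v * int p = 1" using bezout_int[of "int q" "int p"] by auto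
  have "x [^] int q \<noteq> c [^] p" if c: "c \<in> B" for c
  proof
    assume eq: "x [^] int q = c [^] p"
    have "(x [^] int q) [^] u \<otimes> (x [^] v) [^] int p = x [^] (u * int q + v * int p)"
      using xc by (simp add: int_pow_pow int_pow_mult mult.commute)
    then have "x = (x [^] int q) [^] u \<otimes> (x [^] v) [^] int p" using xc uv by simp
    also have "\<dots> = (c [^] int p) [^] u \<otimes> (x [^] v) [^] int p"
      using eq by (simp only: int_pow_int)
    also have "\<dots> = (c [^] u \<otimes> x [^] v) [^] int p"
      using c xc by (simp add: int_pow_distrib int_pow_pow mult.commute)
    finally have "x = (c [^] u \<otimes> x [^] v) [^] p" by (simp add: int_pow_int)
    moreover have "c [^] u \<otimes> x [^] v \<in> ?A"
      using subgroup_int_pow_closed[OF A] subgroup.m_closed[OF A] x c subset_adjoin[OF B] by blast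
    ultimately show False using npow by blast
  qed
  then obtain \<chi> where \<chi>: "\<chi> \<in> hom (G\<lparr>carrier := B\<rparr>) integer_group" "\<not> int p dvd \<chi> (x [^] int q)"
    using P Aq[OF x] by (blast elim: characters_detect_powersE)
  have "(\<lambda>y. \<chi> (y [^] int q)) \<in> hom (G\<lparr>carrier := ?A\<rparr>) integer_group"
  proof (rule homI)
    fix y z assume "y \<in> carrier (G\<lparr>carrier := ?A\<rparr>)" "z \<in> carrier (G\<lparr>carrier := ?A\<rparr>)"
    then have yz: "y \<in> ?A" "z \<in> ?A" by auto
    then have "y \<in> carrier G" "z \<in> carrier G" using subgroup.mem_carrier[OF A] by auto
    then show "\<chi> ((y \<otimes>\<^bsub>G\<lparr>carrier := ?A\<rparr>\<^esub> z) [^] int q)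
        = \<chi> (y [^] int q) \<otimes>\<^bsub>integer_group\<^esub> \<chi> (z [^] int q)"
      using \<chi>(1) Aq yz by (simp add: int_pow_distrib hom_def)
  qed simp
  then show "\<exists>\<psi>\<in>hom (G\<lparr>carrier := ?A\<rparr>) integer_group. \<not> int p dvd \<psi> x"
    by (rule bexI[rotated]) (rule \<chi>(2))
qed

text \<open>Put \<open>b\<^sub>0 = a\<^sup>p\<close>. As \<open>b\<^sub>0\<close> is not a \<open>p\<close>-th power in \<open>B\<close> (here torsion-freeness enters), some
character \<open>\<chi>\<^sub>0\<close> of \<open>B\<close> is prime to \<open>p\<close> at \<open>b\<^sub>0\<close>. The multiple \<open>p \<chi>\<^sub>0\<close> extends to the larger group,
with value \<open>\<chi>\<^sub>0(b\<^sub>0)\<close> at \<open>a\<close>, and detects the elements outside \<open>B\<close>. For \<open>x \<in> B\<close> one wants a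
character of \<open>B\<close> that vanishes at \<open>b\<^sub>0\<close>, since it extends by zero at \<open>a\<close>: the antisymmetric
combination \<open>\<chi>\<^sub>0(b\<^sub>0) \<chi>\<^sub>1 - \<chi>\<^sub>1(b\<^sub>0) \<chi>\<^sub>0\<close> does. Its value at \<open>x\<close> is the value of \<open>\<chi>\<^sub>1\<close> at
\<open>x' = x\<^bsup>\<chi>\<^sub>0(b\<^sub>0)\<^esup> b\<^sub>0\<^bsup>-\<chi>\<^sub>0(x)\<^esup>\<close>. If \<open>x\<close> is not a \<open>p\<close>-th power in the larger group,
then \<open>x'\<close> is not one in \<open>B\<close>, so some \<open>\<chi>\<^sub>1\<close> detects it.\<close>
lemma (in comm_group) detect_powers_adjoin_same_prime:
  assumes B: "subgroup B G" and a: "a \<in> carrier G" and p: "Factorial_Ring.prime p"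
    and P: "characters_detect_powers G p B" and tf: "torsion_free G"
    and ap: "a [^] p \<in> B" and aB: "a \<notin> B"
  shows "characters_detect_powers G p (adjoin G B a)"
  unfolding characters_detect_powers_def
proof (intro ballI impI)
  interpret B: subgroup B G by (rule B)
  let ?A = "adjoin G B a"
  have az: "a \<in> group_center G" using a by (simp add: center_eq_carrier)
  have p1: "p \<ge> 1" using prime_gt_0_nat[OF p] by simp
  define b0 where "b0 = a [^] p"
  have b0: "b0 \<in> B" using ap b0_def by simp
  have extend: "\<exists>\<psi>. \<psi> \<in> hom (G\<lparr>carrier := ?A\<rparr>) integer_group \<and>
      (\<forall>b\<in>B. \<forall>m::int. \<psi> (b \<otimes> a [^] m) = \<chi> b + c * m)"
    if \<chi>: "\<chi> \<in> hom (G\<lparr>carrier := B\<rparr>) integer_group" and c: "\<chi> b0 = c * int p" for \<chi> c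
  proof -
    have "\<chi> (a [^] k) = c * k" if ak: "a [^] k \<in> B" for k :: int
    proof -
      obtain j where j: "k = int p * j" "a [^] k = b0 [^] j"
        using prime_dvd_exponent[OF B a aB p ap ak] unfolding b0_def .
      show ?thesis unfolding j(2) hom_int_pow_integer_group[OF B \<chi> b0] c by (simp add: j(1))
    qed
    from hom_extends_to_adjoin[OF B az \<chi> this] show ?thesis by metis
  qed
  have b0_root_free: "b0 \<noteq> c [^] p" if c: "c \<in> B" for c
  proof
    assume eq: "b0 = c [^] p"
    have "(a \<otimes> inv c) [^] p = a [^] p \<otimes> inv (c [^] p)"
      using a c by (simp add: pow_mult_distrib m_comm nat_pow_inv)
    also have "\<dots> = \<one>" using eq a c by (simp add: b0_def)
    finally have "a \<otimes> inv c = \<one>" using tf a c p1 unfolding torsion_free_def by simp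
    then have "a = c" using a c by (metis B.mem_carrier inv_equality inv_inv inv_closed)
    then show False using aB c by simp
  qed
  obtain \<chi>0 where \<chi>0: "\<chi>0 \<in> hom (G\<lparr>carrier := B\<rparr>) integer_group" "\<not> int p dvd \<chi>0 b0"
    using P b0 b0_root_free by (blast elim: characters_detect_powersE)
  fix x assume "x \<in> ?A" and npow: "\<forall>y\<in>?A. x \<noteq> y [^] p"
  then obtain b m where x: "b \<in> B" "x = b \<otimes> a [^] (m::int)" by (auto elim: adjoinE)
  show "\<exists>\<psi>\<in>hom (G\<lparr>carrier := ?A\<rparr>) integer_group. \<not> int p dvd \<psi> x"
  proof (cases "int p dvd m")
    case False
    have "(\<lambda>y. int p * \<chi>0 y) \<in> hom (G\<lparr>carrier := B\<rparr>) integer_group"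
      using \<chi>0(1) by (simp add: hom_def algebra_simps)
    from extend[OF this, of "\<chi>0 b0"] obtain \<psi> where
      \<psi>: "\<psi> \<in> hom (G\<lparr>carrier := ?A\<rparr>) integer_group" "\<psi> x = int p * \<chi>0 b + \<chi>0 b0 * m"
      using x by (auto simp: mult.commute)
    have "\<not> int p dvd \<psi> x"
      using \<psi>(2) prime_not_dvd_int_mult[OF p \<chi>0(2) False] by (simp add: dvd_add_right_iff)
    then show ?thesis using \<psi>(1) by blast
  next
    case True
    then obtain j where j: "m = int p * j" by blast
    have "x \<in> B"
      using x b0 a subgroup_int_pow_closed[OF B b0, of j]
      by (simp add: j b0_def int_pow_pow flip: int_pow_int)
    define c where "c = \<chi>0 b0"
    define e where "e = \<chi>0 x"
    \<comment> \<open>the combination of \<open>x\<close> and \<open>b0\<close> that \<open>\<chi>0\<close> kills\<close>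
    define x' where "x' = x [^] c \<otimes> inv (b0 [^] e)"
    have x': "x' \<in> B"
      unfolding x'_def using \<open>x \<in> B\<close> b0 subgroup_int_pow_closed[OF B] by blast
    have "coprime c (int p)"
      using \<chi>0(2) p prime_imp_coprime[of "int p" c] by (simp add: c_def coprime_commute)
    then obtain u v where uv: "u * c + v * int p = 1" using bezout_int[of c "int p"] by auto
    have xc: "x \<in> carrier G" and b0c: "b0 \<in> carrier G" using \<open>x \<in> B\<close> b0 by auto
    have "x' \<noteq> d [^] p" if d: "d \<in> B" for d
    proof
      assume eq: "x' = d [^] p"
      have dc: "d \<in> carrier G" using d by simp
      have "x [^] c = x' \<otimes> b0 [^] e" using xc b0c by (simp add: x'_def m_assoc)
      also have "\<dots> = (d \<otimes> a [^] e) [^] int p"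
        using a dc by (simp add: eq b0_def int_pow_distrib int_pow_pow mult.commute flip: int_pow_int)
      finally have xcp: "x [^] c = (d \<otimes> a [^] e) [^] int p" .
      have "x = x [^] (c * u + int p * v)" using uv xc by (simp add: mult.commute)
      also have "\<dots> = (x [^] c) [^] u \<otimes> (x [^] v) [^] int p"
        using xc by (simp add: int_pow_mult int_pow_pow mult.commute)
      also have "\<dots> = ((d \<otimes> a [^] e) [^] u \<otimes> x [^] v) [^] int p"
        using xc dc a unfolding xcp
        by (simp add: int_pow_distrib int_pow_pow mult.commute mult.left_commute mult.assoc)
      finally have "x = ((d \<otimes> a [^] e) [^] u \<otimes> x [^] v) [^] p" by (simp add: int_pow_int)
      moreover have "(d \<otimes> a [^] e) [^] u \<otimes> x [^] v \<in> ?A"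
        using subgroup_int_pow_closed[OF adjoin_subgroup[OF B az]]
          subgroup.m_closed[OF adjoin_subgroup[OF B az]] adjoinI[OF d] subset_adjoin[OF B] \<open>x \<in> B\<close>
        by (meson subsetD)
      ultimately show False using npow by blast
    qed
    then obtain \<chi>1 where \<chi>1: "\<chi>1 \<in> hom (G\<lparr>carrier := B\<rparr>) integer_group" "\<not> int p dvd \<chi>1 x'"
      using P x' by (blast elim: characters_detect_powersE)
    have "(\<lambda>y. c * \<chi>1 y - \<chi>1 b0 * \<chi>0 y) \<in> hom (G\<lparr>carrier := B\<rparr>) integer_group"
      using \<chi>0(1) \<chi>1(1) by (simp add: hom_def algebra_simps)
    from extend[OF this, of 0] obtain \<psi> where
      \<psi>: "\<psi> \<in> hom (G\<lparr>carrier := ?A\<rparr>) integer_group"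
        "\<And>b. b \<in> B \<Longrightarrow> \<psi> b = c * \<chi>1 b - \<chi>1 b0 * \<chi>0 b"
      by (auto simp: c_def mult.commute) (metis B.mem_carrier int_pow_0 r_one)
    have "\<chi>1 x' = \<chi>1 (x [^] c \<otimes> b0 [^] (-e))" using b0c by (simp add: x'_def int_pow_neg)
    also have "\<dots> = \<chi>1 (x [^] c) + \<chi>1 (b0 [^] (-e))"
      using \<chi>1(1) \<open>x \<in> B\<close> b0 subgroup_int_pow_closed[OF B] by (simp add: hom_def)
    also have "\<dots> = c * \<chi>1 x - e * \<chi>1 b0"
      unfolding hom_int_pow_integer_group[OF B \<chi>1(1) \<open>x \<in> B\<close>]
        hom_int_pow_integer_group[OF B \<chi>1(1) b0] by simp
    finally have "\<psi> x = \<chi>1 x'" using \<psi>(2)[OF \<open>x \<in> B\<close>] by (simp add: e_def mult.commute)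
    then show ?thesis using \<psi>(1) \<chi>1(2) by metis
  qed
qed

lemma (in comm_group) detect_powers_adjoin:
  assumes B: "subgroup B G" and a: "a \<in> carrier G" and p: "Factorial_Ring.prime p"
    and P: "characters_detect_powers G p B" and tf: "torsion_free G"
  shows "characters_detect_powers G p (adjoin G B a)"
proof (cases "\<forall>k::int. a [^] k \<in> B \<longrightarrow> k = 0")
  case True
  then show ?thesis using detect_powers_adjoin_independent[OF B a P] by blast
next
  case False
  then obtain k :: int where k: "a [^] k \<in> B" "k \<noteq> 0" by blast
  have "a [^] int (nat \<bar>k\<bar>) \<in> B"
    using k a subgroup.m_inv_closed[OF B k(1)] by (cases "k \<ge> 0") (auto simp: int_pow_neg)
  then have d: "a [^] (nat \<bar>k\<bar>) \<in> B" by (simp only: int_pow_int)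
  define \<Phi> where "\<Phi> K \<longleftrightarrow> subgroup K G \<and> characters_detect_powers G p K" for K
  have az: "a \<in> group_center G" using a by (simp add: center_eq_carrier)
  have "\<Phi> (adjoin G B a)"
  proof (rule adjoin_by_prime_steps[of \<Phi> B a "nat \<bar>k\<bar>"])
    fix K a' q assume K: "\<Phi> K" and a': "a' \<in> group_center G" and q: "Factorial_Ring.prime (q::nat)"
      and a'q: "a' [^] q \<in> K"
    have sK: "subgroup K G" and PK: "characters_detect_powers G p K" using K by (auto simp: \<Phi>_def)
    note a'c = center_carrier[OF a']
    have "characters_detect_powers G p (adjoin G K a')"
      using detect_powers_adjoin_same_prime[OF sK a'c p PK tf] adjoin_mem[OF sK, of a'] PK a'q
        detect_powers_adjoin_other_prime[OF sK a'c p PK q] by (cases "p = q"; cases "a' \<in> K"; simp)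
    then show "\<Phi> (adjoin G K a')" using adjoin_subgroup[OF sK a'] by (simp add: \<Phi>_def)
  qed (use B P az d k in \<open>auto simp: \<Phi>_def\<close>)
  then show ?thesis by (simp add: \<Phi>_def)
qed

lemma (in comm_group) finitely_generated_detect_powers:
  assumes "finite S" "S \<subseteq> carrier G" and p: "Factorial_Ring.prime p" and tf: "torsion_free G"
  shows "characters_detect_powers G p (generate G S)"
  using assms(1,2)
proof (induction S)
  case empty
  have "\<one> [^] p = \<one>" by simp
  then show ?case by (auto simp: characters_detect_powers_def generate_empty)
next
  case (insert a S)
  then have "a \<in> group_center G" by (simp add: center_eq_carrier)
  then show ?case
    using insert generate_insert_eq_adjoin[of S a]
      detect_powers_adjoin[OF generate_is_subgroup[of S] _ p _ tf] by simp
qed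

section \<open>Isolators and torsion\<close>

lemma mem_isolator_iff: "x \<in> isolator M S \<longleftrightarrow> x \<in> carrier M \<and> (\<exists>k::nat\<ge>1. x [^]\<^bsub>M\<^esub> k \<in> S)"
  by (auto simp: isolator_def)

lemma (in group) commutator_mem_derived:
  "x \<in> carrier G \<Longrightarrow> y \<in> carrier G \<Longrightarrow> x \<otimes> y \<otimes> inv x \<otimes> inv y \<in> derived G (carrier G)"
  unfolding derived_def by (rule generate.incl) blast

lemma (in group) normal_of_derived_subset:
  assumes N: "subgroup N G" and D: "derived G (carrier G) \<subseteq> N"
  shows "N \<lhd> G"
  unfolding normal_inv_iff
proof (intro conjI ballI N)
  fix x n assume x: "x \<in> carrier G" and n: "n \<in> N"
  have nc: "n \<in> carrier G" using n subgroup.mem_carrier[OF N] by simp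
  have "x \<otimes> n \<otimes> inv x = (x \<otimes> n \<otimes> inv x \<otimes> inv n) \<otimes> n" using x nc by (simp add: m_assoc)
  also have "\<dots> \<in> N" using commutator_mem_derived[OF x nc] D n subgroup.m_closed[OF N] by blast
  finally show "x \<otimes> n \<otimes> inv x \<in> N" .
qed

lemma (in group) comm_group_Mod:
  assumes N: "subgroup N G" and D: "derived G (carrier G) \<subseteq> N"
  shows "comm_group (G Mod N)"
proof -
  interpret N: normal N G by (rule normal_of_derived_subset[OF N D])
  show ?thesis
  proof (rule group.group_comm_groupI[OF N.factorgroup_is_group])
    fix U V assume "U \<in> carrier (G Mod N)" "V \<in> carrier (G Mod N)"
    then obtain x y where x: "x \<in> carrier G" "U = N #> x" and y: "y \<in> carrier G" "V = N #> y"
      by (auto simp: carrier_FactGroup)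
    have "inv y \<otimes> (y \<otimes> x) = x" using x y by (simp flip: m_assoc)
    then have "x \<otimes> y = (x \<otimes> y \<otimes> inv x \<otimes> inv y) \<otimes> (y \<otimes> x)"
      using x y by (simp add: m_assoc)
    also have "\<dots> \<in> N #> (y \<otimes> x)"
      using commutator_mem_derived[OF x(1) y(1)] D by (auto simp: r_coset_def)
    finally have "N #> (y \<otimes> x) = N #> (x \<otimes> y)"
      using x y by (intro repr_independence N.subgroup_axioms) auto
    then show "U \<otimes>\<^bsub>G Mod N\<^esub> V = V \<otimes>\<^bsub>G Mod N\<^esub> U" using x y by (simp add: N.rcos_sum)
  qed
qed

lemma (in comm_group) torsion_subgroup: "subgroup (isolator G {\<one>}) G"
proof (rule subgroupI)
  have "\<one> [^] (1::nat) = \<one>" by simp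
  then show "isolator G {\<one>} \<noteq> {}" unfolding isolator_def by blast
next
  fix x assume "x \<in> isolator G {\<one>}"
  then obtain k :: nat where "x \<in> carrier G" "k \<ge> 1" "x [^] k = \<one>" by (auto simp: mem_isolator_iff)
  then show "inv x \<in> isolator G {\<one>}" by (auto simp: mem_isolator_iff nat_pow_inv intro!: exI[of _ k])
next
  fix x y assume "x \<in> isolator G {\<one>}" "y \<in> isolator G {\<one>}"
  then obtain k l :: nat where x: "x \<in> carrier G" "k \<ge> 1" "x [^] k = \<one>"
    and y: "y \<in> carrier G" "l \<ge> 1" "y [^] l = \<one>" by (auto simp: mem_isolator_iff)
  have "(x \<otimes> y) [^] (k * l) = (x [^] k) [^] l \<otimes> (y [^] l) [^] k"
    using x(1) y(1) by (simp add: nat_pow_distrib nat_pow_pow mult.commute)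
  then show "x \<otimes> y \<in> isolator G {\<one>}"
    using x y by (auto simp: mem_isolator_iff intro!: exI[of _ "k * l"])
qed (auto simp: isolator_def)

lemma (in normal) mem_isolator_iff_torsion:
  assumes "x \<in> carrier G"
  shows "x \<in> isolator G H \<longleftrightarrow> H #> x \<in> isolator (G Mod H) {\<one>\<^bsub>G Mod H\<^esub>}"
proof -
  have "x [^] k \<in> H \<longleftrightarrow> (H #> x) [^]\<^bsub>G Mod H\<^esub> k = H" for k :: nat
    using coset_join1[OF _ _ subgroup_axioms, of "x [^] k"] coset_join2[OF _ subgroup_axioms, of "x [^] k"]
      assms by (auto simp: FactGroup_pow)
  then show ?thesis using assms by (auto simp: mem_isolator_iff carrier_FactGroup)
qed

lemma (in group) isolator_subgroup:
  assumes N: "subgroup N G" and D: "derived G (carrier G) \<subseteq> N"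
  shows "subgroup (isolator G N) G"
proof -
  interpret N: normal N G by (rule normal_of_derived_subset[OF N D])
  interpret Q: comm_group "G Mod N" by (rule comm_group_Mod[OF N D])
  note T = Q.torsion_subgroup
  note iff = N.mem_isolator_iff_torsion
  show ?thesis
  proof (rule subgroupI)
    show "isolator G N \<subseteq> carrier G" by (auto simp: isolator_def)
    then have mem: "x \<in> isolator G N \<Longrightarrow> x \<in> carrier G" for x by blast
    have "\<one> [^] (1::nat) \<in> N" by simp
    then show "isolator G N \<noteq> {}" unfolding isolator_def by blast
    fix x assume x: "x \<in> isolator G N"
    note xc = mem[OF x]
    have "N #> inv x = inv\<^bsub>G Mod N\<^esub> (N #> x)"
      using xc by (simp add: N.inv_FactGroup carrier_FactGroup N.rcos_inv)
    then show "inv x \<in> isolator G N"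
      using iff[of x] iff[of "inv x"] x xc subgroup.m_inv_closed[OF T] by simp
    fix y assume y: "y \<in> isolator G N"
    show "x \<otimes> y \<in> isolator G N"
      using iff[of x] iff[of y] iff[of "x \<otimes> y"] x y xc mem[OF y]
        subgroup.m_closed[OF T, of "N #> x" "N #> y"] by (simp add: N.rcos_sum)
  qed
qed

lemma (in monoid) subset_isolator: "S \<subseteq> carrier G \<Longrightarrow> S \<subseteq> isolator G S"
proof
  fix x assume "S \<subseteq> carrier G" "x \<in> S"
  then have "x [^] (1::nat) \<in> S" using nat_pow_eone[of x] by auto
  then show "x \<in> isolator G S" using \<open>x \<in> S\<close> \<open>S \<subseteq> carrier G\<close> by (auto simp: mem_isolator_iff)
qed

lemma (in group) isolator_root_closed:
  "x \<in> carrier G \<Longrightarrow> (k::nat) \<ge> 1 \<Longrightarrow> x [^] k \<in> isolator G N \<Longrightarrow> x \<in> isolator G N"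
  unfolding mem_isolator_iff
proof (elim conjE exE)
  fix l :: nat assume "x \<in> carrier G" "k \<ge> 1" "l \<ge> 1" "(x [^] k) [^] l \<in> N"
  then show "x \<in> carrier G \<and> (\<exists>k::nat\<ge>1. x [^] k \<in> N)"
    by (auto simp: nat_pow_pow intro!: exI[of _ "k * l"])
qed

lemma (in group) torsion_free_Mod_isolator:
  assumes N: "subgroup N G" and D: "derived G (carrier G) \<subseteq> N"
  shows "torsion_free (G Mod isolator G N)"
proof -
  have sub: "subgroup (isolator G N) G" by (rule isolator_subgroup[OF N D])
  have "derived G (carrier G) \<subseteq> isolator G N"
    using D subset_isolator[OF subgroup.subset[OF N]] by blast
  then interpret I: normal "isolator G N" G by (rule normal_of_derived_subset[OF sub])
  show ?thesis unfolding torsion_free_def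
  proof (intro ballI allI impI)
    fix U and k :: nat assume "U \<in> carrier (G Mod isolator G N)" and k: "k \<ge> 1"
      and eq: "U [^]\<^bsub>G Mod isolator G N\<^esub> k = \<one>\<^bsub>G Mod isolator G N\<^esub>"
    then obtain x where x: "x \<in> carrier G" "U = isolator G N #> x" by (auto simp: carrier_FactGroup)
    have "isolator G N #> (x [^] k) = isolator G N" using eq x by (simp add: I.FactGroup_pow)
    then have "x [^] k \<in> isolator G N" using coset_join1[OF _ _ sub] x by simp
    then have "x \<in> isolator G N" using isolator_root_closed x k by blast
    then show "U = \<one>\<^bsub>G Mod isolator G N\<^esub>" using coset_join2[OF x(1) sub] x by simp
  qed
qed

text \<open>An argument without the structure theorem. Torsion elements in one and the same coset \<open>B a\<^sup>m\<close> differ by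
torsion of \<open>B\<close>, so each coset contributes finitely many. If no power of \<open>a\<close> but the trivial one lies in
\<open>B\<close>, torsion elements occur in \<open>B\<close> alone; otherwise there are only finitely many cosets.\<close>
lemma (in comm_group) finite_torsion_adjoin:
  assumes B: "subgroup B G" and a: "a \<in> carrier G" and fin: "finite (B \<inter> isolator G {\<one>})"
  shows "finite (adjoin G B a \<inter> isolator G {\<one>})"
proof -
  interpret B: subgroup B G by (rule B)
  note T = torsion_subgroup
  define coset where "coset m = {y. \<exists>b\<in>B. y = b \<otimes> a [^] (m::int) \<and> y \<in> isolator G {\<one>}}" for m
  have finite_coset: "finite (coset m)" for m
  proof (cases "coset m = {}")
    case False
    then obtain t where "t \<in> coset m" by blast
    then obtain b where b: "b \<in> B" "t = b \<otimes> a [^] m" "t \<in> isolator G {\<one>}" by (auto simp: coset_def)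
    have tc: "t \<in> carrier G" using b a by simp
    have "coset m \<subseteq> (\<lambda>s. s \<otimes> t) ` (B \<inter> isolator G {\<one>})"
    proof
      fix y assume "y \<in> coset m"
      then obtain c where c: "c \<in> B" "y = c \<otimes> a [^] m" "y \<in> isolator G {\<one>}" by (auto simp: coset_def)
      have "y \<otimes> inv t = c \<otimes> inv b"
        using c(1) b(1) a unfolding c(2) b(2) by (simp add: inv_mult m_ac)
      then have "y \<otimes> inv t \<in> B \<inter> isolator G {\<one>}"
        using b c subgroup.m_closed[OF T c(3) subgroup.m_inv_closed[OF T b(3)]] by simp
      moreover have "y = (y \<otimes> inv t) \<otimes> t" using c a tc by (simp add: m_assoc)
      ultimately show "y \<in> (\<lambda>s. s \<otimes> t) ` (B \<inter> isolator G {\<one>})" by blast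
    qed
    then show ?thesis using fin finite_surj by blast
  qed simp
  show ?thesis
  proof (cases "\<exists>d::int. d \<noteq> 0 \<and> a [^] d \<in> B")
    case False
    have "adjoin G B a \<inter> isolator G {\<one>} \<subseteq> coset 0"
    proof
      fix y assume y: "y \<in> adjoin G B a \<inter> isolator G {\<one>}"
      then obtain b m where b: "b \<in> B" "y = b \<otimes> a [^] (m::int)" by (auto elim: adjoinE)
      obtain k :: nat where k: "k \<ge> 1" "y [^] k = \<one>" using y by (auto simp: mem_isolator_iff)
      have "b [^] int k \<otimes> a [^] (m * int k) = \<one>"
        using k b a by (simp add: int_pow_distrib int_pow_pow flip: int_pow_int)
      then have "a [^] (m * int k) = inv (b [^] int k)"
        using a b by (metis B.mem_carrier int_pow_closed inv_equality m_comm)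
      also have "\<dots> \<in> B" using b subgroup_int_pow_closed[OF B] B.m_inv_closed by blast
      finally have "m * int k = 0" using False by blast
      then have "m = 0" using k by simp
      then show "y \<in> coset 0" using b y by (auto simp: coset_def)
    qed
    then show ?thesis using finite_coset finite_subset by blast
  next
    case True
    then obtain d :: int where d: "d \<noteq> 0" "a [^] d \<in> B" by blast
    have "adjoin G B a \<inter> isolator G {\<one>} \<subseteq> (\<Union>r\<in>{-\<bar>d\<bar>..\<bar>d\<bar>}. coset r)"
    proof
      fix y assume y: "y \<in> adjoin G B a \<inter> isolator G {\<one>}"
      then obtain b m where b: "b \<in> B" "y = b \<otimes> a [^] (m::int)" by (auto elim: adjoinE)
      have "a [^] m = (a [^] d) [^] (m div d) \<otimes> a [^] (m mod d)"
        using int_pow_mult[OF a, of "d * (m div d)" "m mod d"] int_pow_pow[OF a, of d "m div d"] by simp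
      then have "y = (b \<otimes> (a [^] d) [^] (m div d)) \<otimes> a [^] (m mod d)"
        using b a by (simp add: m_assoc)
      moreover have "b \<otimes> (a [^] d) [^] (m div d) \<in> B" using b d subgroup_int_pow_closed[OF B] by simp
      ultimately have "y \<in> coset (m mod d)" using y by (auto simp: coset_def)
      moreover have "m mod d \<in> {-\<bar>d\<bar>..\<bar>d\<bar>}" using abs_mod_less[OF d(1), of m] by auto
      ultimately show "y \<in> (\<Union>r\<in>{-\<bar>d\<bar>..\<bar>d\<bar>}. coset r)" by blast
    qed
    then show ?thesis using finite_coset by (meson finite_UN finite_atLeastAtMost_int finite_subset)
  qed
qed

lemma (in comm_group) finitely_generated_finite_torsion:
  assumes "finite S" "S \<subseteq> carrier G"
  shows "finite (generate G S \<inter> isolator G {\<one>})"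
  using assms
proof (induction S)
  case (insert a S)
  then have "a \<in> group_center G" by (simp add: center_eq_carrier)
  then show ?case
    using insert generate_insert_eq_adjoin[of S a] finite_torsion_adjoin[OF generate_is_subgroup[of S], of a]
    by simp
qed (simp add: generate_empty)

lemma (in group_hom) derived_hom_trivial:
  assumes "comm_group H" "x \<in> derived G (carrier G)"
  shows "h x = \<one>\<^bsub>H\<^esub>"
proof -
  have "derived H (h ` carrier G) = {\<one>\<^bsub>H\<^esub>}"
    by (rule comm_group.derived_eq_singleton[OF assms(1)]) auto
  then have "h ` derived G (carrier G) = {\<one>\<^bsub>H\<^esub>}" by (simp add: derived_img)
  then show ?thesis using assms(2) by blast
qed

text \<open>A homomorphism to an abelian group factors through \<open>G/G'\<close>, so finite generation of the latter
suffices for that of the image.\<close>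
lemma (in group_hom) finitely_generated_abelian_image:
  assumes H: "comm_group H" and fg: "finitely_generated_group (G Mod commutator_subgroup G)"
  obtains S where "finite S" "S \<subseteq> carrier H" "h ` carrier G = generate H S"
proof -
  interpret D: normal "commutator_subgroup G" G by (rule G.derived_self_is_normal)
  interpret Q: group "G Mod commutator_subgroup G" by (rule D.factorgroup_is_group)
  have "h x = h y" if xy: "x \<in> carrier G" "y \<in> carrier G"
    and eq: "commutator_subgroup G #>\<^bsub>G\<^esub> x = commutator_subgroup G #>\<^bsub>G\<^esub> y" for x y
  proof -
    have "x \<in> commutator_subgroup G #>\<^bsub>G\<^esub> y" using eq G.rcos_self[OF xy(1) D.subgroup_axioms] by simp
    then obtain c where "c \<in> commutator_subgroup G" "x = c \<otimes> y" by (auto simp: r_coset_def)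
    then show ?thesis using derived_hom_trivial[OF H] xy D.mem_carrier by simp
  qed
  from FactGroup_universal[OF homh D.normal_axioms this] obtain g
    where g: "g \<in> hom (G Mod commutator_subgroup G) H"
      "\<And>x. x \<in> carrier G \<Longrightarrow> g (commutator_subgroup G #>\<^bsub>G\<^esub> x) = h x" by blast
  interpret g: group_hom "G Mod commutator_subgroup G" H g
    using g(1) by unfold_locales
  obtain S where S: "finite S" "S \<subseteq> carrier (G Mod commutator_subgroup G)"
    "generate (G Mod commutator_subgroup G) S = carrier (G Mod commutator_subgroup G)"
    using fg by (auto simp: finitely_generated_group_def)
  have "h ` carrier G = g ` carrier (G Mod commutator_subgroup G)"
    using g(2) by (simp add: carrier_FactGroup image_image)
  then have "h ` carrier G = generate H (g ` S)" using g.generate_img[OF S(2)] S(3) by simp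
  moreover have "g ` S \<subseteq> carrier H" using S(2) g.hom_closed by blast
  ultimately show thesis using that S(1) by blast
qed

text \<open>These cosets form the torsion subgroup of the finitely generated abelian group \<open>G/N\<close>.\<close>
lemma (in group) finite_isolator_cosets:
  assumes fg: "finitely_generated_group (G Mod commutator_subgroup G)"
    and N: "subgroup N G" and D: "derived G (carrier G) \<subseteq> N"
  shows "finite ((\<lambda>x. N #> x) ` isolator G N)"
proof -
  interpret N: normal N G by (rule normal_of_derived_subset[OF N D])
  interpret Q: comm_group "G Mod N" by (rule comm_group_Mod[OF N D])
  interpret \<pi>: group_hom G "G Mod N" "\<lambda>x. N #> x"
    using N.r_coset_hom_Mod by unfold_locales
  obtain S where S: "finite S" "S \<subseteq> carrier (G Mod N)"
    "(\<lambda>x. N #> x) ` carrier G = generate (G Mod N) S"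
    by (rule \<pi>.finitely_generated_abelian_image[OF Q.comm_group_axioms fg])
  have "(\<lambda>x. N #> x) ` isolator G N \<subseteq> generate (G Mod N) S \<inter> isolator (G Mod N) {\<one>\<^bsub>G Mod N\<^esub>}"
  proof
    fix U assume "U \<in> (\<lambda>x. N #> x) ` isolator G N"
    then obtain x where x: "x \<in> isolator G N" "U = N #> x" by blast
    then have "x \<in> carrier G" by (simp add: isolator_def)
    then show "U \<in> generate (G Mod N) S \<inter> isolator (G Mod N) {\<one>\<^bsub>G Mod N\<^esub>}"
      using x S(3) N.mem_isolator_iff_torsion[of x] by blast
  qed
  then show ?thesis using Q.finitely_generated_finite_torsion[OF S(1,2)] finite_subset by blast
qed

section \<open>One central root of prime degree\<close>

text \<open>The isomorphism behind cancellation. Rescaling \<open>\<chi>\<close> by an inverse modulo \<open>p\<close> gives a character \<open>\<psi>\<close> with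
\<open>\<psi>(a\<^sup>p) = 1 + c p\<close>. In \<open>\<langle>K, a\<rangle> \<times> \<int>\<close> take the copy \<open>{(g, \<psi> g)}\<close> of \<open>K\<close> and the central
element \<open>(a, c)\<close>. The quotient of \<open>(a\<^sup>p, \<psi>(a\<^sup>p))\<close> by \<open>(a, c)\<^sup>p\<close> is \<open>(1, 1)\<close>, so together they generate
everything, and they meet trivially since \<open>(a, c)\<^bsup>p j\<^esup>\<close> and the element of the graph above \<open>a\<^bsup>p j\<^esup>\<close> have second
components that differ by \<open>j\<close>.\<close>
lemma (in group) adjoin_times_integers_iso:
  assumes K: "subgroup K G" and a: "a \<in> group_center G" "a \<notin> K"
    and p: "Factorial_Ring.prime p" "a [^] p \<in> K"
    and \<chi>: "\<chi> \<in> hom (G\<lparr>carrier := K\<rparr>) integer_group" "\<not> int p dvd \<chi> (a [^] p)"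
  shows "(G\<lparr>carrier := K\<rparr>) \<times>\<times> integer_group \<cong> (G\<lparr>carrier := adjoin G K a\<rparr>) \<times>\<times> integer_group"
proof -
  interpret K: subgroup K G by (rule K)
  note ac = center_carrier[OF a(1)]
  have "coprime (\<chi> (a [^] p)) (int p)"
    using \<chi>(2) p(1) prime_imp_coprime[of "int p" "\<chi> (a [^] p)"] by (simp add: coprime_commute)
  then obtain u v where uv: "u * \<chi> (a [^] p) + v * int p = 1"
    using bezout_int[of "\<chi> (a [^] p)" "int p"] by auto
  define \<psi> where "\<psi> y = u * \<chi> y" for y
  have \<psi>: "\<psi> \<in> hom (G\<lparr>carrier := K\<rparr>) integer_group"
    using \<chi>(1) by (simp add: hom_def \<psi>_def algebra_simps)
  define c where "c = - v"
  have \<psi>a: "\<psi> (a [^] p) = 1 + c * int p" using uv by (simp add: \<psi>_def c_def)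
  have \<psi>_mult: "\<psi> (x \<otimes> y) = \<psi> x + \<psi> y" if "x \<in> K" "y \<in> K" for x y
    using \<psi> that by (simp add: hom_def)
  have \<psi>_pow: "\<psi> ((a [^] p) [^] j) = j * (1 + c * int p)" for j :: int
    using hom_int_pow_integer_group[OF K \<psi> p(2)] \<psi>a by simp
  \<comment> \<open>the powers of \<open>(a, c)\<close> times the graph of \<open>\<psi>\<close>\<close>
  define F where "F = (\<lambda>(g, m::int). (g \<otimes> a [^] m, \<psi> g + c * m))"
  let ?L = "(G\<lparr>carrier := K\<rparr>) \<times>\<times> integer_group"
  let ?R = "(G\<lparr>carrier := adjoin G K a\<rparr>) \<times>\<times> integer_group"
  interpret GK: group "G\<lparr>carrier := K\<rparr>" by (rule subgroup_imp_group[OF K])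
  interpret GA: group "G\<lparr>carrier := adjoin G K a\<rparr>"
    by (rule subgroup_imp_group[OF adjoin_subgroup[OF K a(1)]])
  have hom: "F \<in> hom ?L ?R"
  proof (rule homI)
    fix x y assume "x \<in> carrier ?L" "y \<in> carrier ?L"
    then obtain g m g' m' where "x = (g, m)" "g \<in> K" "y = (g', m')" "g' \<in> K" by auto
    then show "F (x \<otimes>\<^bsub>?L\<^esub> y) = F x \<otimes>\<^bsub>?R\<^esub> F y"
      by (simp add: F_def \<psi>_mult mult_center_pow[OF a(1)] algebra_simps)
  qed (auto simp: F_def intro: adjoinI)
  interpret F: group_hom ?L ?R F
    using hom DirProd_group[OF GK.group_axioms group_integer_group]
      DirProd_group[OF GA.group_axioms group_integer_group]
    by (simp add: group_hom_def group_hom_axioms_def)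
  have ker: "x = \<one>\<^bsub>?L\<^esub>" if x: "x \<in> carrier ?L" "F x = \<one>\<^bsub>?R\<^esub>" for x
  proof -
    obtain g m where gm: "x = (g, m)" "g \<in> K" using x(1) by auto
    then have 1: "g \<otimes> a [^] m = \<one>" and 2: "\<psi> g + c * m = 0" using x(2) by (auto simp: F_def)
    have inv: "a [^] m = inv g"
      using 1 gm(2) ac by (metis K.mem_carrier int_pow_closed inv_equality inv_inv)
    then have "a [^] m \<in> K" using gm(2) by simp
    then obtain j where j: "m = int p * j" "a [^] m = (a [^] p) [^] j"
      using prime_dvd_exponent[OF K ac a(2) p] by blast
    have "0 = \<psi> (g \<otimes> a [^] m)" using 1 hom_int_pow_integer_group[OF K \<psi> K.one_closed, of 0] by simp
    also have "\<dots> = \<psi> g + j * (1 + c * int p)"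
      using \<psi>_mult[OF gm(2) \<open>a [^] m \<in> K\<close>] by (simp add: j(2) \<psi>_pow)
    finally have "j = 0" using 2 j(1) by (simp add: algebra_simps)
    then have "m = 0" using j(1) by simp
    then show ?thesis using 1 gm by simp
  qed
  have surj: "y \<in> F ` carrier ?L" if y: "y \<in> carrier ?R" for y
  proof -
    obtain g m r where g: "g \<in> K" "y = (g \<otimes> a [^] (m::int), r)"
      using y by (auto elim!: adjoinE)
    \<comment> \<open>\<open>(a\<^sup>p)\<^bsup>-j\<^esup>\<close> and \<open>(a, c)\<^bsup>p j\<^esup>\<close> cancel in the first component and shift the second by \<open>-j\<close>\<close>
    define j where "j = \<psi> g + c * m - r"
    have ap: "(a [^] p) [^] (-j) \<in> K" using p(2) subgroup_int_pow_closed[OF K] by blast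
    have "(a [^] p) [^] (-j) = a [^] (- (int p * j))"
      using int_pow_pow[OF ac, of "int p" "-j"] by (simp only: int_pow_int mult_minus_right)
    then have "(a [^] p) [^] (-j) \<otimes> a [^] (m + int p * j) = a [^] m"
      using ac int_pow_mult[OF ac, of "- (int p * j)" "m + int p * j"] by simp
    then have "g \<otimes> (a [^] p) [^] (-j) \<otimes> a [^] (m + int p * j) = g \<otimes> a [^] m"
      using g(1) ac ap by (simp add: m_assoc)
    moreover have "\<psi> (g \<otimes> (a [^] p) [^] (-j)) + c * (m + int p * j) = r"
      unfolding \<psi>_mult[OF g(1) ap] \<psi>_pow by (simp add: j_def algebra_simps)
    ultimately have "F (g \<otimes> (a [^] p) [^] (-j), m + int p * j) = y" by (simp add: F_def g(2))
    moreover have "(g \<otimes> (a [^] p) [^] (-j), m + int p * j) \<in> carrier ?L" using g(1) ap by simp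
    ultimately show ?thesis by (metis imageI)
  qed
  have "F \<in> iso ?L ?R" unfolding F.iso_iff using ker surj by blast
  then show ?thesis by (rule is_isoI)
qed

section \<open>Finite extensions by central elements\<close>

text \<open>Central factors cancel in commutators.\<close>
lemma (in group) derived_subset_if_center_supplement:
  assumes K: "subgroup K G" and KZ: "carrier G = K <#> group_center G"
  shows "derived G (carrier G) \<subseteq> K"
  unfolding derived_def
proof (rule generate_subgroup_incl[OF _ K], safe)
  interpret K: subgroup K G by (rule K)
  fix x y assume "x \<in> carrier G" "y \<in> carrier G"
  then obtain k z l w where x: "x = k \<otimes> z" "k \<in> K" "z \<in> group_center G"
    and y: "y = l \<otimes> w" "l \<in> K" "w \<in> group_center G"
    using KZ unfolding set_mult_def by blast
  have zw: "z \<in> carrier G" "w \<in> carrier G" using center_carrier[OF x(3)] center_carrier[OF y(3)] by auto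
  have prod: "(k' \<otimes> z') \<otimes> (l' \<otimes> w') = (k' \<otimes> l') \<otimes> (z' \<otimes> w')"
    if "k' \<in> K" "l' \<in> K" "z' \<in> group_center G" "w' \<in> group_center G" for k' l' z' w'
  proof -
    have c: "z' \<in> carrier G" "w' \<in> carrier G"
      using center_carrier[OF that(3)] center_carrier[OF that(4)] by auto
    have "(k' \<otimes> z') \<otimes> (l' \<otimes> w') = k' \<otimes> (z' \<otimes> l') \<otimes> w'" using that c by (simp add: m_assoc)
    also have "\<dots> = k' \<otimes> (l' \<otimes> z') \<otimes> w'"
      using center_commutes[OF that(3), of l'] that by simp
    finally show ?thesis using that c by (simp add: m_assoc)
  qed
  have yx: "y \<otimes> x = (l \<otimes> k) \<otimes> (z \<otimes> w)"
    unfolding x(1) y(1) prod[OF y(2) x(2) y(3) x(3)] center_commutes[OF y(3) zw(1)] ..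
  have xy: "x \<otimes> y = (k \<otimes> l) \<otimes> (z \<otimes> w)"
    unfolding x(1) y(1) by (rule prod[OF x(2) y(2) x(3) y(3)])
  have "x \<otimes> y \<otimes> inv x \<otimes> inv y = (x \<otimes> y) \<otimes> inv (y \<otimes> x)"
    using x(1,2) y(1,2) zw by (simp add: inv_mult_group m_assoc)
  also have "\<dots> = (k \<otimes> l) \<otimes> ((z \<otimes> w) \<otimes> inv (z \<otimes> w)) \<otimes> inv (l \<otimes> k)"
    unfolding xy yx using x(2) y(2) zw by (simp add: inv_mult_group m_assoc)
  also have "\<dots> = (k \<otimes> l) \<otimes> inv (l \<otimes> k)" using x(2) y(2) zw by simp
  also have "\<dots> \<in> K" using x(2) y(2) by blast
  finally show "x \<otimes> y \<otimes> inv x \<otimes> inv y \<in> K" .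
qed

lemma (in normal) hom_of_quotient_character:
  assumes K: "subgroup K G" and \<chi>: "\<chi> \<in> hom ((G Mod H)\<lparr>carrier := (\<lambda>x. H #> x) ` K\<rparr>) integer_group"
  shows "(\<lambda>x. \<chi> (H #> x)) \<in> hom (G\<lparr>carrier := K\<rparr>) integer_group"
proof (rule homI)
  fix x y assume "x \<in> carrier (G\<lparr>carrier := K\<rparr>)" "y \<in> carrier (G\<lparr>carrier := K\<rparr>)"
  then have xy: "x \<in> K" "y \<in> K" by auto
  then have "x \<in> carrier G" "y \<in> carrier G" using subgroup.mem_carrier[OF K] by auto
  then have "H #> (x \<otimes> y) = (H #> x) <#> (H #> y)" by (simp add: rcos_sum)
  then show "\<chi> (H #> (x \<otimes>\<^bsub>G\<lparr>carrier := K\<rparr>\<^esub> y)) = \<chi> (H #> x) \<otimes>\<^bsub>integer_group\<^esub> \<chi> (H #> y)"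
    using \<chi> xy by (simp add: hom_def)
qed simp

text \<open>The whole group is reached from \<open>K\<^sub>0\<close> by adjoining central representatives of the finitely many cosets,
one root of prime degree \<open>q\<close> at a time. At each step a character prime to \<open>q\<close> at \<open>a\<^sup>q\<close> is needed.
If none existed, \<open>a\<^sup>q\<close> would agree modulo \<open>D\<close> with a \<open>q\<close>-th power \<open>g\<^sup>q\<close> of some \<open>g \<in> K\<close>. As \<open>a\<close>
commutes with \<open>g\<close>, then \<open>(a g\<^sup>-\<^sup>1)\<^sup>q \<in> D\<close>, hence \<open>a g\<^sup>-\<^sup>1 \<in> D \<subseteq> K\<close> because \<open>D\<close> is isolated, and
\<open>a\<close> would already lie in \<open>K\<close>.\<close>
lemma (in group) finite_central_extension_times_integers_iso:
  defines "D \<equiv> Delta_subgroup G"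
  assumes K0: "subgroup K0 G" "D \<subseteq> K0" and KZ: "carrier G = K0 <#> group_center G"
    and fin: "finite (carrier (G Mod K0))"
    and detect: "\<And>p. Factorial_Ring.prime p \<Longrightarrow>
                   characters_detect_powers (G Mod D) p ((\<lambda>x. D #> x) ` K0)"
  shows "(G\<lparr>carrier := K0\<rparr>) \<times>\<times> integer_group \<cong> G \<times>\<times> integer_group"
proof -
  let ?G' = "derived G (carrier G)"
  have G': "subgroup ?G' G" by (simp add: derived_is_subgroup)
  have D_eq: "D = isolator G ?G'" by (simp add: D_def Delta_subgroup_def)
  have D: "subgroup D G" unfolding D_eq by (rule isolator_subgroup[OF G']) simp
  have G'D: "?G' \<subseteq> D" unfolding D_eq by (rule subset_isolator[OF subgroup.subset[OF G']])
  interpret D: normal D G by (rule normal_of_derived_subset[OF D G'D])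
  interpret Q: comm_group "G Mod D" by (rule comm_group_Mod[OF D G'D])
  have tf: "torsion_free (G Mod D)" unfolding D_eq by (rule torsion_free_Mod_isolator[OF G']) simp
  interpret \<pi>: group_hom G "G Mod D" "\<lambda>x. D #> x"
    using D.r_coset_hom_Mod by unfold_locales
  define \<Phi> where "\<Phi> K \<longleftrightarrow> subgroup K G \<and> K0 \<subseteq> K
      \<and> (\<forall>p. Factorial_Ring.prime p \<longrightarrow> characters_detect_powers (G Mod D) p ((\<lambda>x. D #> x) ` K))
      \<and> (G\<lparr>carrier := K0\<rparr>) \<times>\<times> integer_group \<cong> (G\<lparr>carrier := K\<rparr>) \<times>\<times> integer_group" for K
  have \<Phi>0: "\<Phi> K0" using K0 detect by (auto simp: \<Phi>_def iso_refl)
  have step: "\<Phi> (adjoin G K a)"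
    if \<Phi>: "\<Phi> K" and a: "a \<in> group_center G" and q: "Factorial_Ring.prime q" and aq: "a [^] (q::nat) \<in> K"
    for K a q
  proof (cases "a \<in> K")
    case True
    then show ?thesis using \<Phi> adjoin_mem[of K a] by (simp add: \<Phi>_def)
  next
    case False
    note ac = center_carrier[OF a]
    have K: "subgroup K G" and "K0 \<subseteq> K" using \<Phi> by (auto simp: \<Phi>_def)
    interpret K: subgroup K G by (rule K)
    have detect_K: "characters_detect_powers (G Mod D) p ((\<lambda>x. D #> x) ` K)"
      if "Factorial_Ring.prime p" for p
      using \<Phi> that by (simp add: \<Phi>_def)
    have \<pi>K: "subgroup ((\<lambda>x. D #> x) ` K) (G Mod D)" by (rule \<pi>.subgroup_img_is_subgroup[OF K])
    have no_root: "D #> (a [^] q) \<noteq> V [^]\<^bsub>G Mod D\<^esub> q" if V: "V \<in> (\<lambda>x. D #> x) ` K" for V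
    proof
      assume eq: "D #> (a [^] q) = V [^]\<^bsub>G Mod D\<^esub> q"
      obtain g where g: "g \<in> K" "V = D #> g" using V by blast
      have gc: "g \<in> carrier G" using g by simp
      have "D #> (a [^] q) = D #> (g [^] q)" using eq g gc by (simp add: D.FactGroup_pow)
      then have "a [^] q \<in> D #> (g [^] q)" using rcos_self[OF _ D, of "a [^] q"] ac by simp
      then have "a [^] q \<otimes> inv (g [^] q) \<in> D" using D.rcos_module_imp[OF is_group, of "g [^] q"] gc ac by simp
      moreover have "(a \<otimes> inv g) [^] q = a [^] q \<otimes> inv (g [^] q)"
        using pow_mult_distrib[OF center_commutes[OF a, of "inv g"] ac, of q] gc
        by (simp only: nat_pow_inv inv_closed)
      ultimately have "(a \<otimes> inv g) [^] q \<in> isolator G ?G'" by (simp add: D_eq)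
      then have "a \<otimes> inv g \<in> D"
        unfolding D_eq using isolator_root_closed[of "a \<otimes> inv g" q] ac gc prime_ge_1_nat[OF q] by simp
      then have "a \<otimes> inv g \<otimes> g \<in> K" using K0(2) \<open>K0 \<subseteq> K\<close> g(1) K.m_closed by blast
      then show False using False ac gc by (simp add: m_assoc)
    qed
    obtain \<chi> where \<chi>: "\<chi> \<in> hom ((G Mod D)\<lparr>carrier := (\<lambda>x. D #> x) ` K\<rparr>) integer_group"
        "\<not> int q dvd \<chi> (D #> (a [^] q))"
      using characters_detect_powersE[OF detect_K[OF q] imageI[OF aq] no_root] .
    have "(G\<lparr>carrier := K\<rparr>) \<times>\<times> integer_group \<cong> (G\<lparr>carrier := adjoin G K a\<rparr>) \<times>\<times> integer_group"
      by (rule adjoin_times_integers_iso[OF K a False q aq D.hom_of_quotient_character[OF K \<chi>(1)] \<chi>(2)])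
    then have "(G\<lparr>carrier := K0\<rparr>) \<times>\<times> integer_group \<cong> (G\<lparr>carrier := adjoin G K a\<rparr>) \<times>\<times> integer_group"
      using \<Phi> iso_trans unfolding \<Phi>_def by blast
    moreover have "characters_detect_powers (G Mod D) p ((\<lambda>x. D #> x) ` adjoin G K a)"
      if p: "Factorial_Ring.prime p" for p
      unfolding \<pi>.image_adjoin[OF K.subset ac]
      by (rule Q.detect_powers_adjoin[OF \<pi>K \<pi>.hom_closed[OF ac] p detect_K[OF p] tf])
    moreover have "K0 \<subseteq> adjoin G K a" using \<open>K0 \<subseteq> K\<close> subset_adjoin[OF K] by blast
    ultimately show ?thesis using adjoin_subgroup[OF K a] by (simp add: \<Phi>_def)
  qed
  have K0_normal: "K0 \<lhd> G" using normal_of_derived_subset[OF K0(1)] G'D K0(2) by blast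
  interpret K0: normal K0 G by (rule K0_normal)
  interpret QK0: group "G Mod K0" by (rule K0.factorgroup_is_group)
  have pow_mem: "x [^] order (G Mod K0) \<in> K0" if x: "x \<in> carrier G" for x
  proof -
    have "K0 #> (x [^] order (G Mod K0)) = K0"
      using QK0.pow_order_eq_1[of "K0 #> x"] x by (simp add: K0.FactGroup_pow carrier_FactGroup)
    then show ?thesis using coset_join1[OF _ _ K0(1)] x by simp
  qed
  have "carrier (G Mod K0) \<subseteq> (\<lambda>z. K0 #> z) ` group_center G"
  proof
    fix U assume "U \<in> carrier (G Mod K0)"
    then obtain x where x: "x \<in> carrier G" "U = K0 #> x" by (auto simp: carrier_FactGroup)
    obtain k z where kz: "k \<in> K0" "z \<in> group_center G" "x = k \<otimes> z"
      using KZ x(1) by (auto simp: set_mult_def)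
    have "x \<in> K0 #> z" using kz by (auto simp: r_coset_def)
    then have "K0 #> z = U"
      unfolding x(2) using repr_independence[OF _ center_carrier[OF kz(2)] K0(1)] by blast
    then show "U \<in> (\<lambda>z. K0 #> z) ` group_center G" using kz(2) by blast
  qed
  then obtain S where S: "S \<subseteq> group_center G" "finite S" "carrier (G Mod K0) = (\<lambda>z. K0 #> z) ` S"
    using finite_subset_image[OF fin] by metis
  have "\<exists>K. \<Phi> K \<and> S \<subseteq> K" using S(2,1)
  proof (induction S)
    case empty
    then show ?case using \<Phi>0 by blast
  next
    case (insert z S)
    then obtain K where K: "\<Phi> K" "S \<subseteq> K" by blast
    have z: "z \<in> group_center G" using insert.prems by simp
    have "z [^] order (G Mod K0) \<in> K" using pow_mem[OF center_carrier[OF z]] K(1) by (auto simp: \<Phi>_def)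
    moreover have "order (G Mod K0) \<ge> 1" using QK0.order_gt_0_iff_finite fin by simp
    ultimately have "\<Phi> (adjoin G K z)"
      using adjoin_by_prime_steps[of \<Phi> K z "order (G Mod K0)"] step K(1) z unfolding \<Phi>_def by blast
    moreover have "subgroup K G" using K(1) by (simp add: \<Phi>_def)
    then have "insert z S \<subseteq> adjoin G K z"
      using K(2) subset_adjoin mem_adjoin center_carrier[OF z] by blast
    ultimately show ?case by blast
  qed
  then obtain K where K: "\<Phi> K" "S \<subseteq> K" by blast
  have sK: "subgroup K G" and "K0 \<subseteq> K" using K(1) by (auto simp: \<Phi>_def)
  have "K = carrier G"
  proof
    show "K \<subseteq> carrier G" by (rule subgroup.subset[OF sK])
    show "carrier G \<subseteq> K"
    proof
      fix x assume x: "x \<in> carrier G"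
      then have "K0 #> x \<in> (\<lambda>z. K0 #> z) ` S" using S(3) by (auto simp: carrier_FactGroup)
      then obtain s where s: "s \<in> S" "K0 #> x = K0 #> s" by blast
      then have "x \<in> K0 #> s" using rcos_self[OF x K0(1)] by simp
      then show "x \<in> K" using s(1) K(2) \<open>K0 \<subseteq> K\<close> subgroup.m_closed[OF sK] by (auto simp: r_coset_def)
    qed
  qed
  then show ?thesis using K(1) by (simp add: \<Phi>_def)
qed

section \<open>The embedding obtained from an isomorphism\<close>

text \<open>With \<open>t\<close> the product of the primes that divide \<open>K\<close> but not \<open>b\<close>, every prime divisor of \<open>K\<close> divides
exactly one of \<open>b\<close> and \<open>t w\<close>.\<close>
lemma coprime_shift:
  fixes b w K :: int
  assumes "coprime b w" "K \<noteq> 0"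
  obtains t where "coprime (b - t * w) K"
proof
  define P where "P = {q. Factorial_Ring.prime q \<and> q dvd K \<and> \<not> q dvd b}"
  have "finite P" using finite_prime_divisors[OF assms(2)] by (rule finite_subset[rotated]) (auto simp: P_def)
  define t where "t = \<Prod>P"
  show "coprime (b - t * w) K"
  proof (rule ccontr)
    assume "\<not> coprime (b - t * w) K"
    then have "\<not> is_unit (gcd (b - t * w) K)" by (simp add: coprime_iff_gcd_eq_1)
    moreover have "gcd (b - t * w) K \<noteq> 0" using assms(2) by simp
    ultimately obtain q where "q dvd gcd (b - t * w) K" "Factorial_Ring.prime q"
      using prime_divisor_exists by blast
    then have q: "Factorial_Ring.prime q" "q dvd b - t * w" "q dvd K" by auto
    show False
    proof (cases "q dvd b")
      case True
      then have "q dvd t * w" using q(2) by (simp add: dvd_diff_right_iff)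
      moreover have "\<not> q dvd w"
        using coprime_common_divisor[OF assms(1) True] q(1) not_prime_unit by blast
      ultimately have "q dvd t" using q(1) prime_dvd_mult_iff by blast
      then obtain r where r: "r \<in> P" "q dvd r"
        using prime_dvd_prod_iff[OF \<open>finite P\<close>, of q "\<lambda>x. x"] q(1) by (auto simp: t_def)
      then have "q = r" using q(1) primes_dvd_imp_eq by (auto simp: P_def)
      then show False using r True by (simp add: P_def)
    next
      case False
      then have "q dvd t" using q \<open>finite P\<close> by (auto simp: t_def P_def intro: dvd_prodI)
      then have "q dvd b - t * w + t * w" using q(2) by (intro dvd_add) auto
      then show False using False by simp
    qed
  qed
qed

definition coprime_central_embedding ::
  "('a, 'm) monoid_scheme \<Rightarrow> ('b, 'n) monoid_scheme \<Rightarrow> nat \<Rightarrow> ('a \<Rightarrow> 'b) \<Rightarrow> bool" where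
  "coprime_central_embedding G H k f \<longleftrightarrow> f \<in> hom G H \<and> inj_on f (carrier G)
     \<and> carrier H = (f ` carrier G) <#>\<^bsub>H\<^esub> group_center H
     \<and> finite (carrier (H Mod (f ` carrier G)))
     \<and> coprime (order (H Mod (f ` carrier G))) k"

text \<open>Write the isomorphism as \<open>\<theta>(x, m) = (\<alpha> x m, \<beta> x m)\<close>. The obvious map \<open>x \<mapsto> \<alpha> x 0\<close> need not be
injective, nor its image of finite index; its index is governed by the number \<open>b\<close> with
\<open>\<theta>(g\<^sub>0, b) = (1, 1)\<close>. Replacing the factor \<open>G\<close> by the complement \<open>{(x, t \<beta> x 0)}\<close> of \<open>\<int>\<close> changes \<open>b\<close> to
\<open>c = b - t w\<close> with \<open>w = \<beta> g\<^sub>0 0\<close>. Evaluating \<open>\<beta>\<close> at \<open>(g\<^sub>0, b)\<close> shows \<open>1 = w + b \<beta> 1 1\<close>, so \<open>b\<close> and \<open>w\<close>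
are coprime and \<open>c\<close> can be made nonzero and prime to \<open>k\<close>. The cokernel is cyclic, generated by the central
element \<open>h\<^sub>1 = \<alpha> 1 1\<close>, and its order divides \<open>c\<close>.\<close>
lemma coprime_central_embedding_if_times_integers_iso:
  fixes G :: "('a, 'm) monoid_scheme" (structure) and H :: "('b, 'n) monoid_scheme"
  assumes G: "group G" and H: "group H"
    and iso: "G \<times>\<times> integer_group \<cong> H \<times>\<times> integer_group" and k: "k \<ge> 1"
  obtains f where "coprime_central_embedding G H k f"
proof -
  interpret G: group G by (rule G)
  interpret H: group H by (rule H)
  let ?A = "G \<times>\<times> integer_group" and ?B = "H \<times>\<times> integer_group"
  interpret A: group ?A by (rule DirProd_group[OF G group_integer_group])
  interpret B: group ?B by (rule DirProd_group[OF H group_integer_group])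
  obtain \<theta> where \<theta>: "\<theta> \<in> iso ?A ?B" using iso by (auto simp: is_iso_def)
  then have \<theta>_hom: "\<theta> \<in> hom ?A ?B" and \<theta>_bij: "bij_betw \<theta> (carrier ?A) (carrier ?B)"
    by (auto simp: iso_def)
  interpret \<theta>: group_hom ?A ?B \<theta>
    using \<theta>_hom by unfold_locales
  define \<alpha> where "\<alpha> x m = fst (\<theta> (x, m))" for x and m :: int
  define \<beta> where "\<beta> x m = snd (\<theta> (x, m))" for x and m :: int
  have \<theta>_eq: "\<theta> (x, m) = (\<alpha> x m, \<beta> x m)" for x m by (simp add: \<alpha>_def \<beta>_def)
  have \<alpha>_closed: "\<alpha> x m \<in> carrier H" if "x \<in> carrier G" for x m
    using \<theta>.hom_closed[of "(x, m)"] that by (simp add: \<theta>_eq)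
  have mult: "\<alpha> (x \<otimes> y) (m + n) = \<alpha> x m \<otimes>\<^bsub>H\<^esub> \<alpha> y n \<and> \<beta> (x \<otimes> y) (m + n) = \<beta> x m + \<beta> y n"
    if "x \<in> carrier G" "y \<in> carrier G" for x y m n
    using \<theta>.hom_mult[of "(x, m)" "(y, n)"] that by (simp add: \<theta>_eq)
  have inj: "x = y \<and> m = n" if "\<alpha> x m = \<alpha> y n" "\<beta> x m = \<beta> y n" "x \<in> carrier G" "y \<in> carrier G" for x y m n
    using inj_onD[OF bij_betw_imp_inj_on[OF \<theta>_bij], of "(x, m)" "(y, n)"] that by (simp add: \<theta>_eq)
  have surj: "\<exists>x m. x \<in> carrier G \<and> \<alpha> x m = y \<and> \<beta> x m = r" if "y \<in> carrier H" for y r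
  proof -
    have "(y, r) \<in> \<theta> ` carrier ?A" using \<theta>_bij that by (simp add: bij_betw_def)
    then obtain x m where "x \<in> carrier G" "\<theta> (x, m) = (y, r)" by auto
    then show ?thesis unfolding \<theta>_eq prod.inject by blast
  qed
  have pow: "\<alpha> (x [^] m) (n * m) = \<alpha> x n [^]\<^bsub>H\<^esub> m \<and> \<beta> (x [^] m) (n * m) = m * \<beta> x n"
    if x: "x \<in> carrier G" for x and n m :: int
  proof -
    have "(\<lambda>m. \<alpha> (x [^] m) (n * m)) \<in> hom integer_group H"
      "(\<lambda>m. \<beta> (x [^] m) (n * m)) \<in> hom integer_group integer_group"
      using x mult by (auto simp: hom_def \<alpha>_closed G.int_pow_mult distrib_left)
    from hom_int_pow[OF this(1) _ group_integer_group H, of 1 m]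
      hom_int_pow[OF this(2) _ group_integer_group group_integer_group, of 1 m]
    show ?thesis using x by simp
  qed
  define h1 where "h1 = \<alpha> \<one> 1"
  have h1: "h1 \<in> carrier H" by (simp add: h1_def \<alpha>_closed)
  have \<alpha>_one: "\<alpha> \<one> m = h1 [^]\<^bsub>H\<^esub> m" and \<beta>_one: "\<beta> \<one> m = m * \<beta> \<one> 1" for m
    using pow[of \<one> m 1] by (simp_all add: h1_def)
  \<comment> \<open>the preimage of the generator of the second factor\<close>
  obtain g0 b where g0: "g0 \<in> carrier G" "\<alpha> g0 b = \<one>\<^bsub>H\<^esub>" "\<beta> g0 b = 1"
    using surj[of "\<one>\<^bsub>H\<^esub>" 1] by auto
  define w where "w = \<beta> g0 0"
  have "w + b * \<beta> \<one> 1 = 1"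
    using mult[OF g0(1) G.one_closed, of 0 b] g0 \<beta>_one[of b] by (simp add: w_def)
  then have "coprime b w"
    by (intro coprimeI) (metis dvd_add dvd_mult2)
  \<comment> \<open>the factor 2 excludes that the shifted number is 0 when \<open>k = 1\<close>\<close>
  then obtain t where t: "coprime (b - t * w) (2 * int k)"
    using coprime_shift[of b w "2 * int k"] k by auto
  define c where "c = b - t * w"
  have c0: "c \<noteq> 0" using t k by (auto simp: c_def)
  have ck: "coprime c (int k)" using t by (simp add: c_def)
  define f where "f x = \<alpha> x (t * \<beta> x 0)" for x
  have f_hom: "f \<in> hom G H"
  proof (rule homI)
    fix x y assume xy: "x \<in> carrier G" "y \<in> carrier G"
    then have "\<beta> (x \<otimes> y) 0 = \<beta> x 0 + \<beta> y 0" using mult[OF xy, of 0 0] by simp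
    then show "f (x \<otimes> y) = f x \<otimes>\<^bsub>H\<^esub> f y"
      using mult[OF xy, of "t * \<beta> x 0" "t * \<beta> y 0"] by (simp add: f_def distrib_left)
  qed (simp add: f_def \<alpha>_closed)
  interpret f: group_hom G H f using f_hom by unfold_locales
  have f_inj: "inj_on f (carrier G)"
  proof (rule f.trivial_ker_imp_inj, rule equalityI; rule subsetI)
    fix x assume "x \<in> kernel G H f"
    then have x: "x \<in> carrier G" "f x = \<one>\<^bsub>H\<^esub>" by (auto simp: kernel_def)
    define s where "s = \<beta> x (t * \<beta> x 0)"
    have "x = g0 [^] s \<and> t * \<beta> x 0 = b * s"
    proof (rule inj)
      show "\<alpha> x (t * \<beta> x 0) = \<alpha> (g0 [^] s) (b * s)" using x(2) pow[OF g0(1), of s b] g0 by (simp add: f_def)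
      show "\<beta> x (t * \<beta> x 0) = \<beta> (g0 [^] s) (b * s)" using pow[OF g0(1), of s b] g0 by (simp add: s_def)
    qed (use x g0 in auto)
    then have xs: "x = g0 [^] s" "t * \<beta> x 0 = b * s" by auto
    have "\<beta> x 0 = s * w" using pow[OF g0(1), of s 0] by (simp add: xs(1) w_def)
    then have "s * c = 0" using xs(2) by (auto simp: c_def mult.left_commute mult.commute)
    then show "x \<in> {\<one>}" using c0 xs(1) by simp
  qed (auto simp: kernel_def)
  let ?K = "f ` carrier G"
  have K: "subgroup ?K H" by (rule f.img_is_subgroup)
  have h1_center: "h1 \<in> group_center H"
    unfolding group_center_def
  proof (intro CollectI conjI ballI h1)
    fix y assume "y \<in> carrier H"
    then obtain x m where x: "x \<in> carrier G" "\<alpha> x m = y" using surj[of y 0] by blast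
    show "h1 \<otimes>\<^bsub>H\<^esub> y = y \<otimes>\<^bsub>H\<^esub> h1"
      using mult[OF x(1) G.one_closed, of m 1] mult[OF G.one_closed x(1), of 1 m] x
      by (simp add: h1_def add.commute)
  qed
  have decomp: "\<exists>x m. x \<in> carrier G \<and> y = f x \<otimes>\<^bsub>H\<^esub> h1 [^]\<^bsub>H\<^esub> (m::int)" if y: "y \<in> carrier H" for y
  proof -
    obtain x m where x: "x \<in> carrier G" "\<alpha> x m = y" using surj[OF y, of 0] by blast
    have "y = f x \<otimes>\<^bsub>H\<^esub> h1 [^]\<^bsub>H\<^esub> (m - t * \<beta> x 0)"
      using mult[OF x(1) G.one_closed, of "t * \<beta> x 0" "m - t * \<beta> x 0"] x
      by (simp add: f_def \<alpha>_one)
    then show ?thesis using x(1) by blast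
  qed
  have KZ: "carrier H = ?K <#>\<^bsub>H\<^esub> group_center H"
  proof
    show "carrier H \<subseteq> ?K <#>\<^bsub>H\<^esub> group_center H"
      using decomp H.center_int_pow[OF h1_center] by (fastforce simp: set_mult_def)
    show "?K <#>\<^bsub>H\<^esub> group_center H \<subseteq> carrier H"
      by (intro H.setmult_subset_G subgroup.subset[OF K] subgroup.subset[OF H.center_subgroup])
  qed
  interpret K: normal ?K H
    by (rule H.normal_of_derived_subset[OF K H.derived_subset_if_center_supplement[OF K KZ]])
  interpret Q: group "H Mod ?K" by (rule K.factorgroup_is_group)
  define U where "U = ?K #>\<^bsub>H\<^esub> h1"
  have U: "U \<in> carrier (H Mod ?K)" using h1 by (simp add: U_def carrier_FactGroup)
  have U_pow: "U [^]\<^bsub>H Mod ?K\<^esub> m = ?K #>\<^bsub>H\<^esub> (h1 [^]\<^bsub>H\<^esub> m)" for m :: int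
    using h1 by (simp add: U_def K.FactGroup_int_pow)
  have "carrier (H Mod ?K) \<subseteq> generate (H Mod ?K) {U}"
  proof
    fix V assume "V \<in> carrier (H Mod ?K)"
    then obtain y where y: "y \<in> carrier H" "V = ?K #>\<^bsub>H\<^esub> y" by (auto simp: carrier_FactGroup)
    obtain x m where x: "x \<in> carrier G" "y = f x \<otimes>\<^bsub>H\<^esub> h1 [^]\<^bsub>H\<^esub> (m::int)" using decomp[OF y(1)] by blast
    have "y \<in> ?K #>\<^bsub>H\<^esub> (h1 [^]\<^bsub>H\<^esub> m)" using x by (auto simp: r_coset_def)
    then have "V = U [^]\<^bsub>H Mod ?K\<^esub> m"
      unfolding y(2) U_pow using H.repr_independence[OF _ _ K] h1 by (metis H.int_pow_closed)
    then show "V \<in> generate (H Mod ?K) {U}" using Q.generate_pow[OF U] by blast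
  qed
  then have "generate (H Mod ?K) {U} = carrier (H Mod ?K)"
    using Q.generate_in_carrier[of "{U}"] U by blast
  then have order: "order (H Mod ?K) = Q.ord U" by (simp add: order_def Q.generate_pow_card[OF U])
  have "h1 [^]\<^bsub>H\<^esub> c \<in> ?K"
  proof -
    have "\<beta> (g0 [^] (-1::int)) 0 = - w" using pow[OF g0(1), of "-1" 0] by (simp add: w_def)
    then have "f (g0 [^] (-1::int)) = \<alpha> (\<one> \<otimes> g0 [^] (-1::int)) (c + b * (-1))"
      using g0 by (simp add: f_def c_def)
    also have "\<dots> = \<alpha> \<one> c \<otimes>\<^bsub>H\<^esub> \<alpha> (g0 [^] (-1::int)) (b * (-1))" using mult g0(1) by blast
    also have "\<dots> = h1 [^]\<^bsub>H\<^esub> c"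
      unfolding conjunct1[OF pow[OF g0(1), of "-1" b]] g0(2) \<alpha>_one using h1 by simp
    finally have "h1 [^]\<^bsub>H\<^esub> c = f (g0 [^] (-1::int))" by (rule sym)
    then show ?thesis using g0(1) by blast
  qed
  then have "U [^]\<^bsub>H Mod ?K\<^esub> c = \<one>\<^bsub>H Mod ?K\<^esub>"
    unfolding U_pow using H.coset_join2[OF _ K] h1 by simp
  then have dvd: "int (Q.ord U) dvd c" using Q.int_pow_eq_id[OF U] by blast
  then have "order (H Mod ?K) \<noteq> 0" using c0 order by auto
  then have "finite (carrier (H Mod ?K))" by (metis card.infinite order_def)
  moreover have "coprime (order (H Mod ?K)) k"
    using coprime_divisors[OF dvd dvd_refl ck] order by simp
  ultimately show thesis
    using that f_hom f_inj KZ unfolding coprime_central_embedding_def by blast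
qed

section \<open>The isomorphism obtained from an embedding\<close>

text \<open>Cosets of \<open>N\<close> are merged into cosets of \<open>L\<close>, so finiteness of \<open>I(N)/N\<close> suffices. The factors of the
particular \<open>k\<close> are the cases \<open>N = Z(G) G'\<close>, \<open>L = Z(G) \<Delta>(G)\<close> and \<open>N = L = G'\<close>.\<close>
lemma (in group) order_isolator_quotient_pos:
  assumes fg: "finitely_generated_group (G Mod commutator_subgroup G)"
    and N: "subgroup N G" "derived G (carrier G) \<subseteq> N" and L: "subgroup L G" "N \<subseteq> L"
  shows "order (G\<lparr>carrier := isolator G N\<rparr> Mod L) \<ge> 1"
proof -
  have "(\<lambda>x. L #> x) ` isolator G N = (\<lambda>V. L <#> V) ` ((\<lambda>x. N #> x) ` isolator G N)"
  proof -
    have "L #> x = L <#> (N #> x)" if "x \<in> isolator G N" for x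
    proof -
      have "subgroup N (G\<lparr>carrier := L\<rparr>)" by (rule subgroup_incl[OF N(1) L])
      then have "L <#> N = L" by (rule set_mult_subgroup_idem[OF L(1)])
      then show ?thesis
        using setmult_rcos_assoc[OF subgroup.subset[OF L(1)] subgroup.subset[OF N(1)], of x] that
        by (simp add: isolator_def)
    qed
    then show ?thesis by (simp add: image_image)
  qed
  then have "finite ((\<lambda>x. L #> x) ` isolator G N)"
    using finite_isolator_cosets[OF fg N] by simp
  moreover have "isolator G N \<noteq> {}"
    using subgroup.one_closed[OF isolator_subgroup[OF N]] by blast
  ultimately have "card ((\<lambda>x. L #> x) ` isolator G N) \<ge> 1"
    by (simp add: Suc_le_eq card_gt_0_iff)
  then show ?thesis by (simp add: order_def carrier_FactGroup)
qed

lemma (in group) center_set_mult_subgroup: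
  assumes "subgroup K G"
  shows "subgroup (group_center G <#> K) G"
proof -
  have "group_center G \<lhd> G"
    unfolding normal_inv_iff
  proof (intro conjI ballI center_subgroup)
    fix x z assume x: "x \<in> carrier G" and z: "z \<in> group_center G"
    have "x \<otimes> z \<otimes> inv x = z"
      using center_commutes[OF z x, symmetric] center_carrier[OF z] x by (simp add: m_assoc)
    then show "x \<otimes> z \<otimes> inv x \<in> group_center G" using z by simp
  qed
  then show ?thesis by (rule mult_norm_subgroup[OF _ assms])
qed

lemma (in group) subset_center_set_mult: "S \<subseteq> carrier G \<Longrightarrow> S \<subseteq> group_center G <#> S"
proof
  fix x assume "S \<subseteq> carrier G" "x \<in> S"
  then have "\<one> \<otimes> x \<in> group_center G <#> S"
    using subgroup.one_closed[OF center_subgroup] unfolding set_mult_def by blast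
  then show "x \<in> group_center G <#> S" using \<open>S \<subseteq> carrier G\<close> \<open>x \<in> S\<close> by auto
qed

text \<open>Coprimality of the index \<open>n\<close> with \<open>|\<Delta>(H)/H'|\<close> puts \<open>\<Delta>(H)\<close> inside the image of \<open>f\<close>: for \<open>x \<in> \<Delta>(H)\<close> both
\<open>x\<^sup>n\<close> and \<open>x\<^bsup>|\<Delta>(H)/H'|\<^esup>\<close> lie in the image, the latter because the image contains \<open>H'\<close>.\<close>
lemma times_integers_iso_if_coprime_central_embedding:
  assumes G: "group G" and H: "group H"
    and fg: "finitely_generated_group (G Mod commutator_subgroup G)"
    and f: "coprime_central_embedding G H k f"
    and dvd: "order (H\<lparr>carrier := Delta_subgroup H\<rparr> Mod commutator_subgroup H) dvd k"
  shows "G \<times>\<times> integer_group \<cong> H \<times>\<times> integer_group"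
proof -
  interpret H: group H by (rule H)
  have f_hom: "f \<in> hom G H" and f_inj: "inj_on f (carrier G)"
    and KZ: "carrier H = f ` carrier G <#>\<^bsub>H\<^esub> group_center H"
    and fin: "finite (carrier (H Mod f ` carrier G))"
    and cop: "coprime (order (H Mod f ` carrier G)) k"
    using f by (auto simp: coprime_central_embedding_def)
  interpret f: group_hom G H f using G H f_hom by (simp add: group_hom_def group_hom_axioms_def)
  let ?K = "f ` carrier G" and ?D = "Delta_subgroup H" and ?H' = "derived H (carrier H)"
  have K: "subgroup ?K H" by (rule f.img_is_subgroup)
  have H'K: "?H' \<subseteq> ?K" by (rule H.derived_subset_if_center_supplement[OF K KZ])
  have H': "subgroup ?H' H" by (simp add: H.derived_is_subgroup)
  have D: "subgroup ?D H"
    unfolding Delta_subgroup_def by (rule H.isolator_subgroup[OF H']) simp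
  have H'D: "?H' \<subseteq> ?D"
    unfolding Delta_subgroup_def by (rule H.subset_isolator[OF subgroup.subset[OF H']])
  define n where "n = order (H Mod ?K)"
  define T where "T = order (H\<lparr>carrier := ?D\<rparr> Mod ?H')"
  have DK: "?D \<subseteq> ?K"
  proof
    fix x assume x: "x \<in> ?D"
    then have xc: "x \<in> carrier H" using subgroup.mem_carrier[OF D] by blast
    interpret K: normal ?K H by (rule H.normal_of_derived_subset[OF K H'K])
    interpret QK: group "H Mod ?K" by (rule K.factorgroup_is_group)
    have "?K #>\<^bsub>H\<^esub> (x [^]\<^bsub>H\<^esub> n) = ?K"
      using QK.pow_order_eq_1[of "?K #>\<^bsub>H\<^esub> x"] xc by (simp add: n_def K.FactGroup_pow carrier_FactGroup)
    then have xn: "x [^]\<^bsub>H\<^esub> n \<in> ?K" using H.coset_join1[OF _ _ K] xc by simp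
    interpret HD: group "H\<lparr>carrier := ?D\<rparr>" by (rule H.subgroup_imp_group[OF D])
    interpret N: normal ?H' "H\<lparr>carrier := ?D\<rparr>"
      by (rule H.normal_restrict_supergroup[OF D H.derived_self_is_normal H'D])
    interpret QD: group "H\<lparr>carrier := ?D\<rparr> Mod ?H'" by (rule N.factorgroup_is_group)
    have "?H' #>\<^bsub>H\<lparr>carrier := ?D\<rparr>\<^esub> (x [^]\<^bsub>H\<lparr>carrier := ?D\<rparr>\<^esub> T) = ?H'"
      using QD.pow_order_eq_1[of "?H' #>\<^bsub>H\<lparr>carrier := ?D\<rparr>\<^esub> x"] x N.FactGroup_pow[of x T]
      by (simp add: T_def carrier_FactGroup)
    then have "x [^]\<^bsub>H\<lparr>carrier := ?D\<rparr>\<^esub> T \<in> ?H'"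
      using HD.coset_join1[OF _ _ N.subgroup_axioms] x HD.nat_pow_closed[of x T] by simp
    then have xT: "x [^]\<^bsub>H\<^esub> T \<in> ?K"
      using H'K by (auto simp: H.nat_pow_consistent[of x T ?D])
    have "coprime n T" using coprime_divisors[OF dvd_refl dvd cop] by (simp add: n_def T_def)
    then have "gcd (int n) (int T) = 1" by simp
    then obtain u v where uv: "u * int n + v * int T = 1" using bezout_int[of "int n" "int T"] by auto
    have "x [^]\<^bsub>H\<^esub> (int n * u + int T * v)
        = (x [^]\<^bsub>H\<^esub> n) [^]\<^bsub>H\<^esub> u \<otimes>\<^bsub>H\<^esub> (x [^]\<^bsub>H\<^esub> T) [^]\<^bsub>H\<^esub> v"
      using xc by (simp add: H.int_pow_mult flip: int_pow_int H.int_pow_pow)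
    also have "\<dots> \<in> ?K"
      using subgroup.m_closed[OF K H.subgroup_int_pow_closed[OF K xn] H.subgroup_int_pow_closed[OF K xT]] .
    finally show "x \<in> ?K" using uv xc by (simp add: mult.commute)
  qed
  interpret D: normal ?D H by (rule H.normal_of_derived_subset[OF D H'D])
  interpret Q: comm_group "H Mod ?D" by (rule H.comm_group_Mod[OF D H'D])
  have "(\<lambda>y. ?D #>\<^bsub>H\<^esub> y) \<circ> f \<in> hom G (H Mod ?D)"
    by (rule hom_compose[OF f_hom D.r_coset_hom_Mod])
  then interpret \<rho>: group_hom G "H Mod ?D" "(\<lambda>y. ?D #>\<^bsub>H\<^esub> y) \<circ> f" by unfold_locales
  obtain S where S: "finite S" "S \<subseteq> carrier (H Mod ?D)"
    "((\<lambda>y. ?D #>\<^bsub>H\<^esub> y) \<circ> f) ` carrier G = generate (H Mod ?D) S"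
    by (rule \<rho>.finitely_generated_abelian_image[OF Q.comm_group_axioms fg])
  have tf: "torsion_free (H Mod ?D)"
    unfolding Delta_subgroup_def by (rule H.torsion_free_Mod_isolator[OF H']) simp
  have "characters_detect_powers (H Mod ?D) p ((\<lambda>y. ?D #>\<^bsub>H\<^esub> y) ` ?K)"
    if "Factorial_Ring.prime p" for p
    using Q.finitely_generated_detect_powers[OF S(1,2) that tf] S(3) by (simp add: image_comp)
  then have iso2: "(H\<lparr>carrier := ?K\<rparr>) \<times>\<times> integer_group \<cong> H \<times>\<times> integer_group"
    by (rule H.finite_central_extension_times_integers_iso[OF K DK KZ fin])
  have "f \<in> iso G (H\<lparr>carrier := ?K\<rparr>)"
    using f_hom f_inj by (auto simp: iso_def bij_betw_def hom_def)
  then have "G \<times>\<times> integer_group \<cong> (H\<lparr>carrier := ?K\<rparr>) \<times>\<times> integer_group"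
    using group.DirProd_iso_trans[OF G is_isoI iso_refl] by blast
  then show ?thesis using iso2 iso_trans by blast
qed

section \<open>The three properties are equivalent\<close>

theorem proposition1p2:
  fixes G :: "('a, 'm) monoid_scheme" and H :: "('b, 'n) monoid_scheme"
  assumes "group G" and "group H"
    and "finitely_generated_group (G Mod commutator_subgroup G)"
    and "finitely_generated_group (H Mod commutator_subgroup H)"
  shows "(G \<times>\<times> integer_group \<cong> H \<times>\<times> integer_group \<longleftrightarrow>
      (\<forall>k::nat. k \<ge> 1 \<longrightarrow>
        (\<exists>f \<in> hom G H. inj_on f (carrier G)
           \<and> carrier H = (f ` carrier G) <#>\<^bsub>H\<^esub> group_center H
           \<and> finite (carrier (H Mod (f ` carrier G)))
           \<and> coprime (order (H Mod (f ` carrier G))) k)))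
    \<and> ((\<forall>k::nat. k \<ge> 1 \<longrightarrow>
        (\<exists>f \<in> hom G H. inj_on f (carrier G)
           \<and> carrier H = (f ` carrier G) <#>\<^bsub>H\<^esub> group_center H
           \<and> finite (carrier (H Mod (f ` carrier G)))
           \<and> coprime (order (H Mod (f ` carrier G))) k)) \<longleftrightarrow>
      (let k = order (H\<lparr>carrier := Gamma_subgroup H\<rparr>
                        Mod (group_center H <#>\<^bsub>H\<^esub> Delta_subgroup H))
             * order (H\<lparr>carrier := Delta_subgroup H\<rparr> Mod commutator_subgroup H)
       in \<exists>f \<in> hom G H. inj_on f (carrier G)
           \<and> carrier H = (f ` carrier G) <#>\<^bsub>H\<^esub> group_center H
           \<and> finite (carrier (H Mod (f ` carrier G)))
           \<and> coprime (order (H Mod (f ` carrier G))) k))"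
proof -
  interpret H: group H by (rule assms(2))
  define k0 where "k0 = order (H\<lparr>carrier := Gamma_subgroup H\<rparr>
                        Mod (group_center H <#>\<^bsub>H\<^esub> Delta_subgroup H))
             * order (H\<lparr>carrier := Delta_subgroup H\<rparr> Mod commutator_subgroup H)"
  let ?Z = "group_center H" and ?H' = "commutator_subgroup H"
  have H': "subgroup ?H' H" by (simp add: H.derived_is_subgroup)
  have D: "subgroup (Delta_subgroup H) H"
    unfolding Delta_subgroup_def by (rule H.isolator_subgroup[OF H']) simp
  have H'D: "?H' \<subseteq> Delta_subgroup H"
    unfolding Delta_subgroup_def by (rule H.subset_isolator[OF subgroup.subset[OF H']])
  have "order (H\<lparr>carrier := Delta_subgroup H\<rparr> Mod ?H') \<ge> 1"
    unfolding Delta_subgroup_def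
    by (rule H.order_isolator_quotient_pos[OF assms(4) H' _ H']) simp_all
  moreover have "order (H\<lparr>carrier := Gamma_subgroup H\<rparr> Mod (?Z <#>\<^bsub>H\<^esub> Delta_subgroup H)) \<ge> 1"
    unfolding Gamma_subgroup_def
    by (rule H.order_isolator_quotient_pos[OF assms(4) H.center_set_mult_subgroup[OF H']
          H.subset_center_set_mult[OF subgroup.subset[OF H']] H.center_set_mult_subgroup[OF D]
          mono_set_mult[OF subset_refl H'D]])
  ultimately have k0: "k0 \<ge> 1" unfolding k0_def by (metis mult_le_mono nat_mult_1)
  have 12: "\<exists>f. coprime_central_embedding G H k f"
    if "G \<times>\<times> integer_group \<cong> H \<times>\<times> integer_group" "k \<ge> 1" for k
    by (rule coprime_central_embedding_if_times_integers_iso[OF assms(1,2) that]) (rule exI)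
  have 31: "G \<times>\<times> integer_group \<cong> H \<times>\<times> integer_group" if ex: "\<exists>f. coprime_central_embedding G H k0 f"
  proof -
    obtain f where "coprime_central_embedding G H k0 f" using ex by blast
    then show ?thesis
      by (rule times_integers_iso_if_coprime_central_embedding[OF assms(1-3)]) (simp add: k0_def)
  qed
  have embedding: "(\<exists>f \<in> hom G H. inj_on f (carrier G)
           \<and> carrier H = (f ` carrier G) <#>\<^bsub>H\<^esub> group_center H
           \<and> finite (carrier (H Mod (f ` carrier G)))
           \<and> coprime (order (H Mod (f ` carrier G))) k)
         \<longleftrightarrow> (\<exists>f. coprime_central_embedding G H k f)" for k
    by (auto simp: coprime_central_embedding_def)
  show ?thesis
    unfolding Let_def embedding k0_def[symmetric] using 12 31 k0 by blast
qed

end
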